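(* Let $A,B\in\mathbb P_n$ and let $a,b\ge0$. Then $$\lambda\bigl(a^2A+b^2B+2ab(A\#B)\bigr)\prec_w\lambda\bigl(a^2A+b^2B+ab(A^{1/2}B^{1/2}+B^{1/2}A^{1/2})\bigr).$$ Consequently, $$\|a^2A+b^2B+2ab(A\#B)\|\le\|(aA^{1/2}+bB^{1/2})^2\|$$ for every unitarily invariant norm $\|\cdot\|$ on $n\times n$ complex matrices. In particular, $$\|A+B+2(A\#B)\|\le\|A+B+A^{1/2}B^{1/2}+B^{1/2}A^{1/2}\|$$ for every unitarily invariant norm.
   Context: $\mathbb P_n$ is the set of $n\times n$ complex (Hermitian) positive definite matrices. For a Hermitian matrix $T$, $\lambda(T)$ is the vector of eigenvalues in decreasing order. For $x,y\in\mathbb R^n$ with decreasing rearrangements $x^\downarrow,y^\downarrow$, $x\prec_w y$ means $\sum_{j=1}^k x_j^\downarrow\le\sum_{j=1}^k y_j^\downarrow$ for all $1\le k\le n$. For $P,Q\in\mathbb P_n$, $P\#Q=P^{1/2}(P^{-1/2}QP^{-1/2})^{1/2}P^{1/2}$ is the Kubo-Ando geometric mean. *)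

theory Defs
  imports
    Jordan_Normal_Form.Char_Poly
    Jordan_Normal_Form.Gauss_Jordan_Elimination
    Jordan_Normal_Form.Schur_Decomposition
    "HOL-Library.Multiset"
begin

definition hermitian_mat :: "complex mat \<Rightarrow> bool" where
  "hermitian_mat A \<longleftrightarrow> mat_adjoint A = A"

(* The order on complex numbers is that of HOL-Library.Complex_Order: 0 < z says that z is
   real and positive. *)

definition psd_mats :: "nat \<Rightarrow> complex mat set" where
  "psd_mats n = {A \<in> carrier_mat n n. hermitian_mat A \<and>
     (\<forall>v \<in> carrier_vec n. 0 \<le> (A *\<^sub>v v) \<bullet>c v)}"

definition pd_mats :: "nat \<Rightarrow> complex mat set" where
  "pd_mats n = {A \<in> carrier_mat n n. hermitian_mat A \<and>
     (\<forall>v \<in> carrier_vec n. v \<noteq> 0\<^sub>v n \<longrightarrow> 0 < (A *\<^sub>v v) \<bullet>c v)}"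

(* The unique positive semidefinite square root; meaningful for positive semidefinite P. *)
definition mat_sqrt :: "complex mat \<Rightarrow> complex mat" where
  "mat_sqrt P = (THE R. R \<in> psd_mats (dim_row P) \<and> R * R = P)"

(* mat_inverse is option-valued; the result is meaningful for invertible A only. *)
definition mat_inv :: "complex mat \<Rightarrow> complex mat" where
  "mat_inv A = the (mat_inverse A)"

definition geo_mean :: "complex mat \<Rightarrow> complex mat \<Rightarrow> complex mat" where
  "geo_mean P Q =
     mat_sqrt P * mat_sqrt (mat_inv (mat_sqrt P) * Q * mat_inv (mat_sqrt P)) * mat_sqrt P"

(* Eigenvalues with multiplicity, in decreasing order. Meant for Hermitian T, whose
   eigenvalues are real, so that Re only changes the type. *)
definition eigvals_desc :: "complex mat \<Rightarrow> real list" where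
  "eigvals_desc T = rev (sorted_list_of_multiset (image_mset Re (proots (char_poly T))))"

definition decr_rearr :: "real list \<Rightarrow> real list" where
  "decr_rearr x = rev (sort x)"

definition weakly_majorized :: "real list \<Rightarrow> real list \<Rightarrow> bool" (infix "\<prec>\<^sub>w" 50) where
  "x \<prec>\<^sub>w y \<longleftrightarrow> length x = length y \<and>
     (\<forall>k \<in> {1..length x}. (\<Sum>j<k. decr_rearr x ! j) \<le> (\<Sum>j<k. decr_rearr y ! j))"

definition unitary_mats :: "nat \<Rightarrow> complex mat set" where
  "unitary_mats n = {U \<in> carrier_mat n n.
     mat_adjoint U * U = 1\<^sub>m n \<and> U * mat_adjoint U = 1\<^sub>m n}"

definition mat_norm :: "nat \<Rightarrow> (complex mat \<Rightarrow> real) \<Rightarrow> bool" where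
  "mat_norm n N \<longleftrightarrow>
     (\<forall>X \<in> carrier_mat n n. 0 \<le> N X \<and> (N X = 0 \<longleftrightarrow> X = 0\<^sub>m n n)) \<and>
     (\<forall>X \<in> carrier_mat n n. \<forall>c. N (c \<cdot>\<^sub>m X) = cmod c * N X) \<and>
     (\<forall>X \<in> carrier_mat n n. \<forall>Y \<in> carrier_mat n n. N (X + Y) \<le> N X + N Y)"

definition unitarily_invariant_norm :: "nat \<Rightarrow> (complex mat \<Rightarrow> real) \<Rightarrow> bool" where
  "unitarily_invariant_norm n N \<longleftrightarrow> mat_norm n N \<and>
     (\<forall>X \<in> carrier_mat n n. \<forall>U \<in> unitary_mats n. \<forall>V \<in> unitary_mats n. N (U * X * V) = N X)"

end

theory Submission imports Defs begin

text \<open>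
  Write \<open>P\<close> and \<open>Q\<close> for the positive square roots of \<open>A\<close> and \<open>B\<close>, \<open>G\<close> for their geometric mean,
  and
    \<open>H = a^2 A + b^2 B + 2ab G\<close>,   \<open>S = a P + b Q\<close>,
  so that the matrix on the right side is \<open>S^2\<close>. If \<open>ab = 0\<close>, then \<open>H = S^2\<close>; let \<open>a, b > 0\<close>.

  The matrix \<open>H\<close> is, up to scaling, a power mean of exponent one half: it is built from its own
  geometric means with \<open>A\<close> and \<open>B\<close>. Indeed the geometric mean of \<open>A\<close> and \<open>B\<close> is the positive solution
  of the Riccati equation \<open>G A^-1 G = B\<close>, and this is equivalent to \<open>G B^-1 G = A\<close>
  (\<open>geo_mean_riccati\<close>). Expanding, \<open>X = a A + b G\<close> and \<open>Y = b B + a G\<close> satisfy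
  \<open>X A^-1 X = H = Y B^-1 Y\<close> (\<open>riccati_shift\<close>), that is, \<open>X = A # H\<close> and \<open>Y = B # H\<close>; and
  \<open>H = a X + b Y\<close>.

  Let \<open>E\<close> be the spectral projection of \<open>H\<close> onto its \<open>k\<close> largest eigenvalues. The heart of the
  proof is the inequality \<open>tr E (A # H) \<le> tr E H^(1/2) P\<close>
  (\<open>mat_trace_top_proj_geo_mean_le\<close>). Applied to \<open>A\<close> and to \<open>B\<close> it gives
    \<open>tr E H = a tr E X + b tr E Y \<le> tr E H^(1/2) S \<le> (tr E H + tr E S^2) / 2\<close>,
  where the last step is \<open>tr E (H^(1/2) - S)^2 \<ge> 0\<close> together with the fact that \<open>E\<close> commutes with
  \<open>H^(1/2)\<close>. Hence \<open>tr E H \<le> tr E S^2\<close>. The left side is the sum of the \<open>k\<close> largest eigenvalues of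
  \<open>H\<close>, and the right side is at most that of \<open>S^2\<close> by Ky Fan's principle (\<open>ky_fan\<close>).

  For the central inequality, raise all eigenvalues of \<open>H\<close> outside the range of \<open>E\<close> to the \<open>k\<close>-th
  one, \<open>\<mu>\<close>. The result \<open>H'\<close> dominates both \<open>H\<close> and \<open>\<mu> 1\<close>, so operator monotonicity of the square
  root (\<open>psd_le_of_square_le\<close>) gives \<open>A # H \<le> A # H'\<close> and \<open>\<mu>^(1/2) P \<le> A # H'\<close>. For the full trace
  one has \<open>tr (A # H') \<le> tr P H'^(1/2)\<close> (\<open>mat_trace_geo_mean_le\<close>), which is a consequence of the
  positivity of two traces. On the range of \<open>1 - E\<close>, where \<open>H'^(1/2)\<close> is the scalar \<open>\<mu>^(1/2)\<close>, the lower bound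
  for \<open>A # H'\<close> is exactly \<open>H'^(1/2) P\<close>. Subtracting the two leaves the inequality on the range of \<open>E\<close>,
  where \<open>H\<close> and \<open>H'\<close> agree.

  The statement on norms follows from the majorization by Ky Fan's dominance theorem
  (\<open>ky_fan_dominance\<close>): a unitarily invariant norm restricts on diagonal matrices to a symmetric gauge
  function, and such a function is monotone under weak majorization because the latter is a
  composition of averagings of two coordinates and decreases of one coordinate.
\<close>

section \<open>Adjoints, unitary matrices and traces\<close>

text \<open>The rules for rectangular matrices leave the inner dimensions as unknowns that the simplifier
  cannot find; these are their instances for square matrices of one size.\<close>

lemmas square_mat_closed = mult_carrier_mat[of _ n n _ n] add_carrier_mat[of _ n n]
  minus_carrier_mat[of _ n n] smult_carrier_mat[of _ n n] one_carrier_mat[of n] zero_carrier_mat[of n n] for n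

lemmas square_mat_assoc = assoc_mult_mat[of _ n n _ n _ n] for n

lemmas square_mat_distribs = add_mult_distrib_mat[of _ n n _ _ n] mult_add_distrib_mat[of _ n n _ n]
  minus_mult_distrib_mat[of _ n n _ _ n] mult_minus_distrib_mat[of _ n n _ n]
  mult_smult_distrib[of _ n n _ n] mult_smult_assoc_mat[of _ n n _ n] for n

lemma dim_mat_adjoint [simp]:
  "dim_row (mat_adjoint A) = dim_col A" "dim_col (mat_adjoint A) = dim_row A"
  unfolding mat_adjoint_def by auto

lemma index_mat_adjoint [simp]:
  "i < dim_col A \<Longrightarrow> j < dim_row A \<Longrightarrow> mat_adjoint A $$ (i,j) = conjugate (A $$ (j,i))"
  unfolding mat_adjoint_def mat_of_rows_def by auto

lemma mat_adjoint_carrier [simp]: "A \<in> carrier_mat m n \<Longrightarrow> mat_adjoint A \<in> carrier_mat n m"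
  by (intro carrier_matI) auto

lemma mat_adjoint_adjoint [simp]: "mat_adjoint (mat_adjoint A) = (A :: complex mat)"
  by (rule eq_matI) auto

lemma mat_adjoint_mult:
  fixes A :: "complex mat"
  assumes "A \<in> carrier_mat m k" "B \<in> carrier_mat k n"
  shows "mat_adjoint (A * B) = mat_adjoint B * mat_adjoint A"
proof (rule eq_matI)
  fix i j assume "i < dim_row (mat_adjoint B * mat_adjoint A)" "j < dim_col (mat_adjoint B * mat_adjoint A)"
  then show "mat_adjoint (A * B) $$ (i,j) = (mat_adjoint B * mat_adjoint A) $$ (i,j)"
    using assms by (simp add: scalar_prod_def mult.commute)
qed (use assms in auto)

lemma mat_adjoint_add:
  fixes A :: "complex mat"
  assumes "A \<in> carrier_mat m n" "B \<in> carrier_mat m n"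
  shows "mat_adjoint (A + B) = mat_adjoint A + mat_adjoint B"
  using assms by (intro eq_matI) auto

lemma mat_adjoint_minus:
  fixes A :: "complex mat"
  assumes "A \<in> carrier_mat m n" "B \<in> carrier_mat m n"
  shows "mat_adjoint (A - B) = mat_adjoint A - mat_adjoint B"
  using assms by (intro eq_matI) auto

lemma mat_adjoint_smult: "mat_adjoint (c \<cdot>\<^sub>m (A :: complex mat)) = cnj c \<cdot>\<^sub>m mat_adjoint A"
  by (rule eq_matI) auto

lemma mat_adjoint_one [simp]: "mat_adjoint (1\<^sub>m n :: complex mat) = 1\<^sub>m n"
  by (rule eq_matI) auto

lemma smult_smult_mat: "a \<cdot>\<^sub>m (b \<cdot>\<^sub>m A) = (a * b) \<cdot>\<^sub>m (A :: complex mat)"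
  by (rule eq_matI) auto

lemma adjoint_cscalar_prod:
  fixes A :: "complex mat"
  assumes "A \<in> carrier_mat m n" "v \<in> carrier_vec n" "w \<in> carrier_vec m"
  shows "(A *\<^sub>v v) \<bullet>c w = v \<bullet>c (mat_adjoint A *\<^sub>v w)"
proof -
  have "(A *\<^sub>v v) \<bullet>c w = (\<Sum>i<m. (\<Sum>j<n. A $$ (i,j) * v $ j) * cnj (w $ i))"
    using assms by (auto simp: scalar_prod_def lessThan_atLeast0)
  also have "\<dots> = (\<Sum>i<m. \<Sum>j<n. v $ j * (A $$ (i,j) * cnj (w $ i)))"
    by (simp add: sum_distrib_right sum_distrib_left mult_ac)
  also have "\<dots> = (\<Sum>j<n. \<Sum>i<m. v $ j * (A $$ (i,j) * cnj (w $ i)))"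
    by (rule sum.swap)
  also have "\<dots> = (\<Sum>j<n. v $ j * (\<Sum>i<m. A $$ (i,j) * cnj (w $ i)))"
    by (simp add: sum_distrib_left)
  also have "\<dots> = v \<bullet>c (mat_adjoint A *\<^sub>v w)"
    using assms by (auto simp: scalar_prod_def lessThan_atLeast0 intro!: sum.cong)
  finally show ?thesis .
qed

lemma unitary_matsD:
  assumes "U \<in> unitary_mats n"
  shows "U \<in> carrier_mat n n" "mat_adjoint U \<in> carrier_mat n n"
    "mat_adjoint U * U = 1\<^sub>m n" "U * mat_adjoint U = 1\<^sub>m n"
  using assms unfolding unitary_mats_def by auto

lemma unitary_matsI:
  assumes "U \<in> carrier_mat n n" "mat_adjoint U * U = 1\<^sub>m n"
  shows "U \<in> unitary_mats n"
  using assms mat_mult_left_right_inverse[of "mat_adjoint U" n U] unfolding unitary_mats_def by auto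

lemma unitary_mats_adjoint: "U \<in> unitary_mats n \<Longrightarrow> mat_adjoint U \<in> unitary_mats n"
  unfolding unitary_mats_def by auto

lemma cancel_left_inverse:
  assumes "A * B = 1\<^sub>m n" "A \<in> carrier_mat n n" "B \<in> carrier_mat n n" "X \<in> carrier_mat n n"
  shows "A * (B * X) = (X :: 'a :: semiring_1 mat)"
  using assms by (simp flip: assoc_mult_mat[of A n n B n X n])

lemma unitary_mats_mult:
  assumes "U \<in> unitary_mats n" "V \<in> unitary_mats n"
  shows "U * V \<in> unitary_mats n"
proof (rule unitary_matsI)
  note u = unitary_matsD[OF assms(1)] unitary_matsD[OF assms(2)]
  show "U * V \<in> carrier_mat n n" using u by auto
  show "mat_adjoint (U * V) * (U * V) = 1\<^sub>m n"
    using u by (simp add: mat_adjoint_mult[where m=n and k=n and n=n] square_mat_assoc[where n=n] square_mat_closed[where n=n]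
        cancel_left_inverse[where A="mat_adjoint U" and B=U and n=n])
qed

definition mat_trace :: "complex mat \<Rightarrow> complex" where
  "mat_trace A = (\<Sum>i<dim_row A. A $$ (i,i))"

lemma mat_trace_comm:
  assumes "A \<in> carrier_mat n m" "B \<in> carrier_mat m n"
  shows "mat_trace (A * B) = mat_trace (B * A)"
proof -
  have "mat_trace (A * B) = (\<Sum>i<n. \<Sum>j<m. A $$ (i,j) * B $$ (j,i))"
    using assms by (simp add: mat_trace_def scalar_prod_def lessThan_atLeast0)
  also have "\<dots> = (\<Sum>j<m. \<Sum>i<n. A $$ (i,j) * B $$ (j,i))" by (rule sum.swap)
  also have "\<dots> = mat_trace (B * A)"
    using assms by (simp add: mat_trace_def scalar_prod_def lessThan_atLeast0 mult.commute)
  finally show ?thesis .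
qed

lemma mat_trace_add: "A \<in> carrier_mat n n \<Longrightarrow> B \<in> carrier_mat n n \<Longrightarrow> mat_trace (A + B) = mat_trace A + mat_trace B"
  by (auto simp: mat_trace_def sum.distrib)

lemma mat_trace_minus: "A \<in> carrier_mat n n \<Longrightarrow> B \<in> carrier_mat n n \<Longrightarrow> mat_trace (A - B) = mat_trace A - mat_trace B"
  by (auto simp: mat_trace_def sum_subtractf)

lemma mat_trace_smult: "A \<in> carrier_mat n n \<Longrightarrow> mat_trace (c \<cdot>\<^sub>m A) = c * mat_trace A"
  by (auto simp: mat_trace_def sum_distrib_left)

section \<open>Functions of a unitarily diagonalised matrix\<close>

definition real_diag :: "nat \<Rightarrow> (nat \<Rightarrow> real) \<Rightarrow> complex mat" where
  "real_diag n d = mat n n (\<lambda>(i,j). if i = j then complex_of_real (d i) else 0)"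

lemma real_diag_carrier [simp]: "real_diag n d \<in> carrier_mat n n"
  "dim_row (real_diag n d) = n" "dim_col (real_diag n d) = n"
  unfolding real_diag_def by auto

lemma index_real_diag [simp]:
  "i < n \<Longrightarrow> j < n \<Longrightarrow> real_diag n d $$ (i,j) = (if i = j then complex_of_real (d i) else 0)"
  unfolding real_diag_def by auto

lemma real_diag_mult_vec:
  "v \<in> carrier_vec n \<Longrightarrow> i < n \<Longrightarrow> (real_diag n d *\<^sub>v v) $ i = complex_of_real (d i) * v $ i"
  by (simp add: scalar_prod_def if_distrib[where f="\<lambda>x. x * _"] cong: if_cong)

text \<open>For fixed \<open>U\<close> these are the Hermitian matrices that \<open>U\<close> diagonalises, with the columns of \<open>U\<close> as
  eigenvectors: sums, products and square roots of them act on the eigenvalues \<open>d\<close> alone. All functional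
  calculus below is done in this form. Only the values \<open>d i\<close> with \<open>i < n\<close> matter.\<close>

definition unitary_diag :: "nat \<Rightarrow> complex mat \<Rightarrow> (nat \<Rightarrow> real) \<Rightarrow> complex mat" where
  "unitary_diag n U d = U * real_diag n d * mat_adjoint U"

lemma unitary_diag_carrier [simp]: "U \<in> unitary_mats n \<Longrightarrow> unitary_diag n U d \<in> carrier_mat n n"
  unfolding unitary_diag_def by (auto dest: unitary_matsD intro!: square_mat_closed)

lemma unitary_diag_cong: "(\<And>i. i < n \<Longrightarrow> d i = e i) \<Longrightarrow> unitary_diag n U d = unitary_diag n U e"
  unfolding unitary_diag_def real_diag_def by (intro arg_cong2[where f="(*)"] eq_matI refl) auto

lemma real_diag_mult: "real_diag n d * real_diag n e = real_diag n (\<lambda>i. d i * e i)"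
  by (rule eq_matI) (auto simp: scalar_prod_def if_distrib[where f="\<lambda>x. x * _"] cong: if_cong)

lemma real_diag_add: "real_diag n d + real_diag n e = real_diag n (\<lambda>i. d i + e i)"
  by (rule eq_matI) auto

lemma real_diag_minus: "real_diag n d - real_diag n e = real_diag n (\<lambda>i. d i - e i)"
  by (rule eq_matI) auto

lemma real_diag_smult: "complex_of_real c \<cdot>\<^sub>m real_diag n e = real_diag n (\<lambda>i. c * e i)"
  by (rule eq_matI) auto

lemma mat_adjoint_real_diag: "mat_adjoint (real_diag n d) = real_diag n d"
  by (rule eq_matI) auto

lemma real_diag_one: "real_diag n (\<lambda>_. 1) = 1\<^sub>m n"
  by (rule eq_matI) auto

lemma hermitian_unitary_diag:
  assumes "U \<in> unitary_mats n"
  shows "hermitian_mat (unitary_diag n U d)"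
  using unitary_matsD[OF assms] unfolding hermitian_mat_def unitary_diag_def
  by (simp add: mat_adjoint_mult[where m=n and k=n and n=n] mat_adjoint_real_diag square_mat_assoc[where n=n] square_mat_closed[where n=n])

lemma unitary_diag_mult:
  assumes "U \<in> unitary_mats n"
  shows "unitary_diag n U d * unitary_diag n U e = unitary_diag n U (\<lambda>i. d i * e i)"
  using unitary_matsD[OF assms] unfolding unitary_diag_def
  by (simp add: real_diag_mult[symmetric] square_mat_assoc[where n=n] square_mat_closed[where n=n]
        cancel_left_inverse[where A="mat_adjoint U" and B=U and n=n])

lemma unitary_diag_add:
  assumes "U \<in> unitary_mats n"
  shows "unitary_diag n U d + unitary_diag n U e = unitary_diag n U (\<lambda>i. d i + e i)"
  using unitary_matsD[OF assms] unfolding unitary_diag_def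
  by (simp add: real_diag_add[symmetric] square_mat_distribs[where n=n] square_mat_closed[where n=n])

lemma unitary_diag_minus:
  assumes "U \<in> unitary_mats n"
  shows "unitary_diag n U d - unitary_diag n U e = unitary_diag n U (\<lambda>i. d i - e i)"
  using unitary_matsD[OF assms] unfolding unitary_diag_def
  by (simp add: real_diag_minus[symmetric] square_mat_distribs[where n=n] square_mat_closed[where n=n])

lemma unitary_diag_smult:
  assumes "U \<in> unitary_mats n"
  shows "complex_of_real c \<cdot>\<^sub>m unitary_diag n U d = unitary_diag n U (\<lambda>i. c * d i)"
  using unitary_matsD[OF assms] unfolding unitary_diag_def
  by (simp add: real_diag_smult[symmetric] square_mat_distribs[where n=n] square_mat_closed[where n=n])

lemma unitary_diag_one:
  assumes "U \<in> unitary_mats n"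
  shows "unitary_diag n U (\<lambda>_. 1) = 1\<^sub>m n"
  using unitary_matsD[OF assms] unfolding unitary_diag_def by (simp add: real_diag_one)

lemma unitary_conj_unitary_diag:
  assumes "U \<in> unitary_mats n" "W \<in> unitary_mats n"
  shows "W * unitary_diag n U d * mat_adjoint W = unitary_diag n (W * U) d"
  using unitary_matsD[OF assms(1)] unitary_matsD[OF assms(2)] unfolding unitary_diag_def
  by (simp add: mat_adjoint_mult[where m=n and k=n and n=n] square_mat_assoc[where n=n] square_mat_closed[where n=n])

lemma mat_trace_unitary_diag:
  assumes "U \<in> unitary_mats n"
  shows "mat_trace (unitary_diag n U d) = complex_of_real (\<Sum>i<n. d i)"
proof -
  note u = unitary_matsD[OF assms]
  have "mat_trace (unitary_diag n U d) = mat_trace (U * (real_diag n d * mat_adjoint U))"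
    unfolding unitary_diag_def using u by (simp add: square_mat_assoc[where n=n])
  also have "\<dots> = mat_trace ((real_diag n d * mat_adjoint U) * U)" using u by (intro mat_trace_comm[of _ n n]) auto
  also have "\<dots> = mat_trace (real_diag n d)" using u by (simp add: square_mat_assoc[where n=n])
  finally show ?thesis by (simp add: mat_trace_def)
qed

lemma cscalar_prod_unitary_diag:
  assumes U: "U \<in> unitary_mats n" and v: "v \<in> carrier_vec n"
  shows "(unitary_diag n U d *\<^sub>v v) \<bullet>c v = complex_of_real (\<Sum>i<n. d i * (cmod ((mat_adjoint U *\<^sub>v v) $ i))\<^sup>2)"
proof -
  note u = unitary_matsD[OF U]
  define w where "w = mat_adjoint U *\<^sub>v v"
  have w: "w \<in> carrier_vec n" using mult_mat_vec_carrier[OF u(2) v] unfolding w_def .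
  have "unitary_diag n U d *\<^sub>v v = U *\<^sub>v (real_diag n d *\<^sub>v w)"
    using u v unfolding unitary_diag_def w_def by (simp add: assoc_mult_mat_vec[of _ n n _ n] square_mat_closed[where n=n] mult_mat_vec_carrier[of _ n n])
  then have "(unitary_diag n U d *\<^sub>v v) \<bullet>c v = (real_diag n d *\<^sub>v w) \<bullet>c w"
    using adjoint_cscalar_prod[of U n n "real_diag n d *\<^sub>v w" v] u v w mult_mat_vec_carrier[OF real_diag_carrier(1) w, of d] unfolding w_def by simp
  also have "\<dots> = (\<Sum>i<n. complex_of_real (d i) * (w $ i * cnj (w $ i)))"
    using w by (simp add: scalar_prod_def[of _ "conjugate w"] real_diag_mult_vec lessThan_atLeast0 mult.assoc del: index_mult_mat_vec)
  finally show ?thesis unfolding w_def of_real_sum of_real_mult complex_norm_square .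
qed

section \<open>Positive matrices\<close>

lemma psd_matsD:
  assumes "A \<in> psd_mats n"
  shows "A \<in> carrier_mat n n" "mat_adjoint A = A"
    "v \<in> carrier_vec n \<Longrightarrow> 0 \<le> Re ((A *\<^sub>v v) \<bullet>c v)"
  using assms unfolding psd_mats_def hermitian_mat_def by (auto simp: less_eq_complex_def)

text \<open>The form of a Hermitian matrix is real, so only the sign of its real part has to be checked.\<close>

lemma psd_matsI:
  assumes "A \<in> carrier_mat n n" "mat_adjoint A = A"
    "\<And>v. v \<in> carrier_vec n \<Longrightarrow> 0 \<le> Re ((A *\<^sub>v v) \<bullet>c v)"
  shows "A \<in> psd_mats n"
proof -
  have "Im ((A *\<^sub>v v) \<bullet>c v) = 0" if v: "v \<in> carrier_vec n" for v
  proof -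
    have "(A *\<^sub>v v) \<bullet>c v = v \<bullet>c (A *\<^sub>v v)"
      using adjoint_cscalar_prod[OF assms(1) v v] assms(2) by simp
    also have "\<dots> = conjugate (conjugate v \<bullet> (A *\<^sub>v v))"
      by (rule conjugate_conjugate_sprod[symmetric]) (use v assms(1) in auto)
    also have "conjugate v \<bullet> (A *\<^sub>v v) = (A *\<^sub>v v) \<bullet>c v"
      by (rule conjugate_vec_sprod_comm[symmetric]) (use v assms(1) in auto)
    finally show ?thesis by (simp add: complex_eq_iff)
  qed
  then show ?thesis using assms unfolding psd_mats_def hermitian_mat_def by (auto simp: less_eq_complex_def)
qed

lemma pd_mats_psd: "A \<in> pd_mats n \<Longrightarrow> A \<in> psd_mats n"
proof -
  assume A: "A \<in> pd_mats n"
  have "0 \<le> (A *\<^sub>v v) \<bullet>c v" if "v \<in> carrier_vec n" for v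
  proof (cases "v = 0\<^sub>v n")
    case True
    have "A *\<^sub>v v = 0\<^sub>v n" using A True unfolding pd_mats_def by (intro eq_vecI) auto
    then show ?thesis using True by simp
  next
    case False then show ?thesis using A that unfolding pd_mats_def by (auto simp: order.strict_iff_order)
  qed
  then show ?thesis using A unfolding pd_mats_def psd_mats_def by auto
qed

lemma pd_matsD:
  assumes "A \<in> pd_mats n"
  shows "A \<in> carrier_mat n n" "mat_adjoint A = A"
    "v \<in> carrier_vec n \<Longrightarrow> v \<noteq> 0\<^sub>v n \<Longrightarrow> 0 < Re ((A *\<^sub>v v) \<bullet>c v)"
  using assms unfolding pd_mats_def hermitian_mat_def by (auto simp: less_complex_def)

lemma pd_matsI:
  assumes "A \<in> psd_mats n"
    "\<And>v. v \<in> carrier_vec n \<Longrightarrow> v \<noteq> 0\<^sub>v n \<Longrightarrow> Re ((A *\<^sub>v v) \<bullet>c v) \<noteq> 0"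
  shows "A \<in> pd_mats n"
  using assms unfolding pd_mats_def psd_mats_def by (auto simp: less_complex_def less_eq_complex_def) (metis order.not_eq_order_implies_strict)

lemma unitary_col_form:
  assumes U: "U \<in> unitary_mats n" and i: "i < n"
  shows "(unitary_diag n U d *\<^sub>v col U i) \<bullet>c col U i = complex_of_real (d i)" "col U i \<noteq> 0\<^sub>v n"
proof -
  note u = unitary_matsD[OF U]
  have *: "mat_adjoint U *\<^sub>v col U i = unit_vec n i"
  proof -
    have "mat_adjoint U *\<^sub>v col U i = col (mat_adjoint U * U) i"
      using u i by (intro col_mult2[symmetric, of _ n n _ n]) auto
    then show ?thesis using u i by simp
  qed
  have c: "col U i \<in> carrier_vec n" using u i by auto
  have "(\<Sum>j<n. d j * (cmod (unit_vec n i $ j))\<^sup>2) = (\<Sum>j<n. if j = i then d j else 0)"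
    using i by (intro sum.cong) auto
  then show "(unitary_diag n U d *\<^sub>v col U i) \<bullet>c col U i = complex_of_real (d i)"
    unfolding cscalar_prod_unitary_diag[OF U c] * using i by simp
  show "col U i \<noteq> 0\<^sub>v n"
  proof
    assume "col U i = 0\<^sub>v n"
    moreover have "mat_adjoint U *\<^sub>v 0\<^sub>v n = 0\<^sub>v n" using u by (intro eq_vecI) auto
    ultimately have "unit_vec n i = (0\<^sub>v n :: complex vec)" using * by simp
    then have "unit_vec n i $ i = (0\<^sub>v n :: complex vec) $ i" by simp
    then show False using i by simp
  qed
qed

lemma unitary_diag_psd_iff:
  assumes U: "U \<in> unitary_mats n"
  shows "unitary_diag n U d \<in> psd_mats n \<longleftrightarrow> (\<forall>i<n. 0 \<le> d i)"
proof
  assume A: "unitary_diag n U d \<in> psd_mats n"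
  show "\<forall>i<n. 0 \<le> d i"
  proof (intro allI impI)
    fix i assume i: "i < n"
    then show "0 \<le> d i"
      using psd_matsD(3)[OF A, of "col U i"] unitary_col_form(1)[OF U i, of d] unitary_matsD(1)[OF U] by simp
  qed
next
  assume "\<forall>i<n. 0 \<le> d i"
  then show "unitary_diag n U d \<in> psd_mats n"
    using hermitian_unitary_diag[OF U] U
    by (intro psd_matsI) (auto simp: hermitian_mat_def cscalar_prod_unitary_diag[OF U] intro!: sum_nonneg mult_nonneg_nonneg)
qed

lemma unitary_diag_pd_iff:
  assumes U: "U \<in> unitary_mats n"
  shows "unitary_diag n U d \<in> pd_mats n \<longleftrightarrow> (\<forall>i<n. 0 < d i)"
proof
  assume A: "unitary_diag n U d \<in> pd_mats n"
  show "\<forall>i<n. 0 < d i"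
  proof (intro allI impI)
    fix i assume i: "i < n"
    then show "0 < d i"
      using pd_matsD(3)[OF A, of "col U i"] unitary_col_form(1)[OF U i, of d] unitary_col_form(2)[OF U i] unitary_matsD(1)[OF U] by simp
  qed
next
  assume d: "\<forall>i<n. 0 < d i"
  show "unitary_diag n U d \<in> pd_mats n"
  proof (rule pd_matsI)
    show "unitary_diag n U d \<in> psd_mats n" using d unitary_diag_psd_iff[OF U] by (simp add: less_imp_le)
    fix v :: "complex vec" assume v: "v \<in> carrier_vec n" "v \<noteq> 0\<^sub>v n"
    define w where "w = mat_adjoint U *\<^sub>v v"
    have w: "w \<in> carrier_vec n" using mult_mat_vec_carrier[OF unitary_matsD(2)[OF U] v(1)] unfolding w_def .
    have "U *\<^sub>v w = v" unfolding w_def using unitary_matsD[OF U] v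
      by (simp flip: assoc_mult_mat_vec[of U n n "mat_adjoint U" n v])
    moreover have "U *\<^sub>v 0\<^sub>v n = 0\<^sub>v n" using unitary_matsD[OF U] by (intro eq_vecI) auto
    ultimately have "w \<noteq> 0\<^sub>v n" using v by metis
    then have "\<exists>i<n. w $ i \<noteq> 0" using eq_vecI[of w "0\<^sub>v n"] w by auto
    then obtain i where i: "i < n" "w $ i \<noteq> 0" by blast
    have "0 < (\<Sum>i<n. d i * (cmod (w $ i))\<^sup>2)"
      by (rule sum_pos2[of _ i]) (use d i in \<open>auto simp: less_imp_le\<close>)
    then show "Re ((unitary_diag n U d *\<^sub>v v) \<bullet>c v) \<noteq> 0"
      unfolding cscalar_prod_unitary_diag[OF U v(1)] w_def by simp
  qed
qed

section \<open>The spectral theorem\<close>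

text \<open>Gram-Schmidt applied to a basis that starts with \<open>v\<close> gives orthogonal vectors, which still have to be normalised; this is where the factor \<open>c\<close> comes from.\<close>

lemma unitary_first_col:
  fixes v :: "complex vec"
  assumes v: "v \<in> carrier_vec n" "v \<noteq> 0\<^sub>v n"
  obtains W c where "W \<in> unitary_mats n" "c \<noteq> 0" "col W 0 = c \<cdot>\<^sub>v v"
proof -
  interpret cof_vec_space n "TYPE(complex)" .
  define ws where "ws = gram_schmidt n (basis_completion v)"
  note bc = basis_completion[OF v]
  note gs = gram_schmidt_result[OF bc(2,4,5) ws_def]
  have len: "length ws = n" and orth: "corthogonal ws" and carr: "set ws \<subseteq> carrier_vec n"
    using gs bc(6) by auto
  have n0: "0 < n" using v by (cases n) auto
  obtain us where "basis_completion v = v # us" using bc(6,7) n0 by (cases "basis_completion v") auto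
  then have hd: "ws ! 0 = v" using gram_schmidt_hd[OF v(1), of us] len n0 unfolding ws_def by (metis hd_conv_nth length_greater_0_conv)
  define r where "r j = sqrt (Re (ws ! j \<bullet>c ws ! j))" for j
  have wc: "ws ! j \<in> carrier_vec n" if "j < n" for j using that len carr by auto
  have r: "r j > 0" "ws ! j \<bullet>c ws ! j = (complex_of_real (r j))\<^sup>2" if j: "j < n" for j
  proof -
    have "ws ! j \<bullet>c ws ! j \<noteq> 0" using corthogonalD[OF orth, of j j] j len by auto
    moreover have "0 \<le> ws ! j \<bullet>c ws ! j" by auto
    ultimately have "0 < Re (ws ! j \<bullet>c ws ! j)" "Im (ws ! j \<bullet>c ws ! j) = 0"
      by (auto simp: less_eq_complex_def complex_eq_iff)
    then show "r j > 0" "ws ! j \<bullet>c ws ! j = (complex_of_real (r j))\<^sup>2"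
      unfolding r_def by (auto simp: complex_eq_iff simp flip: of_real_power)
  qed
  define W where "W = mat n n (\<lambda>(i,j). complex_of_real (inverse (r j)) * ws ! j $ i)"
  have W: "W \<in> carrier_mat n n" unfolding W_def by auto
  have "W \<in> unitary_mats n"
  proof (rule unitary_matsI[OF W], rule eq_matI)
    fix i j assume "i < dim_row (1\<^sub>m n :: complex mat)" "j < dim_col (1\<^sub>m n :: complex mat)"
    then have ij: "i < n" "j < n" by auto
    have "(mat_adjoint W * W) $$ (i,j) = (\<Sum>k<n. complex_of_real (inverse (r i) * inverse (r j)) * (ws ! j $ k * cnj (ws ! i $ k)))"
      using ij by (simp add: W_def scalar_prod_def lessThan_atLeast0 mult_ac)
    also have "\<dots> = complex_of_real (inverse (r i) * inverse (r j)) * (ws ! j \<bullet>c ws ! i)"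
      using ij wc[OF ij(1)] by (simp add: sum_distrib_left scalar_prod_def lessThan_atLeast0)
    also have "\<dots> = 1\<^sub>m n $$ (i,j)"
    proof (cases "i = j")
      case True
      then show ?thesis using ij r[OF ij(1)] by (simp add: power2_eq_square field_simps)
    next
      case False
      then have "ws ! j \<bullet>c ws ! i = 0" using corthogonalD[OF orth, of j i] ij len by auto
      then show ?thesis using ij False by simp
    qed
    finally show "(mat_adjoint W * W) $$ (i,j) = 1\<^sub>m n $$ (i,j)" .
  qed (use W in auto)
  moreover have "col W 0 = complex_of_real (inverse (r 0)) \<cdot>\<^sub>v v"
    using n0 v(1) hd by (intro eq_vecI) (auto simp: W_def)
  moreover have "complex_of_real (inverse (r 0)) \<noteq> 0" using r(1)[OF n0] by simp
  ultimately show thesis using that by blast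
qed

lemma mat_adjoint_four_block:
  fixes A :: "complex mat"
  assumes "A \<in> carrier_mat n1 m1" "B \<in> carrier_mat n1 m2" "C \<in> carrier_mat n2 m1" "D \<in> carrier_mat n2 m2"
  shows "mat_adjoint (four_block_mat A B C D) = four_block_mat (mat_adjoint A) (mat_adjoint C) (mat_adjoint B) (mat_adjoint D)"
  using assms by (intro eq_matI) auto

lemma complex_eigenvector_exists:
  fixes A :: "complex mat"
  assumes A: "A \<in> carrier_mat n n" and n: "0 < n"
  obtains v k where "v \<in> carrier_vec n" "v \<noteq> 0\<^sub>v n" "A *\<^sub>v v = k \<cdot>\<^sub>v v"
proof -
  have "degree (char_poly A) = n" using degree_monic_char_poly[OF A] by simp
  then have "\<not> constant (poly (char_poly A))" using n by (simp add: constant_degree)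
  then obtain k where "poly (char_poly A) k = 0" using fundamental_theorem_of_algebra by blast
  then have "eigenvalue A k" using eigenvalue_root_char_poly[OF A] by simp
  then show thesis using that A unfolding eigenvalue_def eigenvector_def by auto
qed

text \<open>By induction on the dimension: in an orthonormal basis that starts with an eigenvector, the first
  column of the matrix has only its first entry nonzero, by symmetry so has the first row, and the
  complementary block is a smaller Hermitian matrix.\<close>

theorem hermitian_spectral:
  assumes "A \<in> carrier_mat n n" "mat_adjoint A = A"
  shows "\<exists>U d. U \<in> unitary_mats n \<and> A = unitary_diag n U d"
  using assms
proof (induction n arbitrary: A)
  case 0
  have "1\<^sub>m 0 \<in> unitary_mats 0" by (intro unitary_matsI) auto
  moreover have "A = unitary_diag 0 (1\<^sub>m 0) (\<lambda>_. 0)" using 0 by (intro eq_matI) (auto simp: unitary_diag_def)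
  ultimately show ?case by blast
next
  case (Suc n)
  obtain v k where v: "v \<in> carrier_vec (Suc n)" "v \<noteq> 0\<^sub>v (Suc n)" and ev: "A *\<^sub>v v = k \<cdot>\<^sub>v v"
    using complex_eigenvector_exists[OF Suc.prems(1)] by blast
  obtain W c where W: "W \<in> unitary_mats (Suc n)" and c: "c \<noteq> 0" "col W 0 = c \<cdot>\<^sub>v v"
    using unitary_first_col[OF v] .
  note w = unitary_matsD[OF W]
  define A' where "A' = mat_adjoint W * A * W"
  have A': "A' \<in> carrier_mat (Suc n) (Suc n)" "mat_adjoint A' = A'"
    using w Suc.prems unfolding A'_def
    by (auto simp add: mat_adjoint_mult[where m="Suc n" and k="Suc n" and n="Suc n"] square_mat_assoc[where n="Suc n"] square_mat_closed[where n="Suc n"])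
  have "A' = mat_adjoint W * (A * W)" unfolding A'_def using w Suc.prems by (simp add: square_mat_assoc[where n="Suc n"])
  then have "col A' 0 = mat_adjoint W *\<^sub>v col (A * W) 0"
    by (simp only:) (rule col_mult2[of _ "Suc n" "Suc n" _ "Suc n"], use w Suc.prems in auto)
  also have "col (A * W) 0 = A *\<^sub>v col W 0"
    by (rule col_mult2[of _ "Suc n" "Suc n" _ "Suc n"]) (use w Suc.prems in auto)
  also have "mat_adjoint W *\<^sub>v (A *\<^sub>v col W 0) = k \<cdot>\<^sub>v (mat_adjoint W *\<^sub>v col W 0)"
    using w Suc.prems v c ev by (simp add: mult_mat_vec[of _ "Suc n" "Suc n"] smult_smult_assoc mult.commute)
  also have "mat_adjoint W *\<^sub>v col W 0 = col (mat_adjoint W * W) 0"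
    using w by (intro col_mult2[symmetric, of _ "Suc n" "Suc n" _ "Suc n"]) auto
  finally have col0: "col A' 0 = k \<cdot>\<^sub>v unit_vec (Suc n) 0" using w by simp
  have e0: "A' $$ (i,0) = (if i = 0 then k else 0)" if "i < Suc n" for i
    using arg_cong[OF col0, of "\<lambda>v. v $ i"] A' that by auto
  \<comment> \<open>The first entry \<open>k\<close> is real, and the first row vanishes elsewhere, because \<open>A'\<close> is Hermitian.\<close>
  have adj: "A' $$ (i,j) = cnj (A' $$ (j,i))" if "i < Suc n" "j < Suc n" for i j
  proof -
    have "mat_adjoint A' $$ (i,j) = cnj (A' $$ (j,i))" using A'(1) that by simp
    then show ?thesis unfolding A'(2) .
  qed
  have e0': "A' $$ (0,j) = (if j = 0 then cnj k else 0)" if "j < Suc n" for j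
    using adj[of 0 j] e0[OF that] that by auto
  have kr: "k = complex_of_real (Re k)" using e0[of 0] e0'[of 0] by (simp add: complex_eq_iff)
  define A3 where "A3 = mat n n (\<lambda>(i,j). A' $$ (Suc i, Suc j))"
  have A3: "A3 \<in> carrier_mat n n" unfolding A3_def by auto
  have "mat_adjoint A3 = A3"
  proof (rule eq_matI)
    fix i j assume "i < dim_row A3" "j < dim_col A3"
    then show "mat_adjoint A3 $$ (i,j) = A3 $$ (i,j)"
      using adj[of "Suc i" "Suc j"] unfolding A3_def by simp
  qed (auto simp: A3_def)
  from Suc.IH[OF A3 this] obtain V d where V: "V \<in> unitary_mats n" and A3eq: "A3 = unitary_diag n V d" by blast
  note vv = unitary_matsD[OF V]
  define F where "F = four_block_mat (1\<^sub>m 1) (0\<^sub>m 1 n) (0\<^sub>m n 1) V"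
  have Fc: "F \<in> carrier_mat (Suc n) (Suc n)" unfolding F_def using vv by auto
  have F': "mat_adjoint F = four_block_mat (1\<^sub>m 1) (0\<^sub>m 1 n) (0\<^sub>m n 1) (mat_adjoint V)"
    unfolding F_def using vv by (subst mat_adjoint_four_block) (auto intro!: arg_cong2[where f="four_block_mat _"] arg_cong2[where f="\<lambda>x y. four_block_mat _ x y _"] eq_matI)
  have "mat_adjoint F * F = four_block_mat (1\<^sub>m 1) (0\<^sub>m 1 n) (0\<^sub>m n 1) (1\<^sub>m n)"
    unfolding F' unfolding F_def using vv by (subst mult_four_block_mat[where ?nr1.0=1 and ?n1.0=1 and ?nr2.0=n and ?n2.0=n and ?nc1.0=1 and ?nc2.0=n]) auto
  also have "\<dots> = 1\<^sub>m (Suc n)" by (rule eq_matI) auto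
  finally have F: "F \<in> unitary_mats (Suc n)" using Fc by (intro unitary_matsI)
  define d' where "d' = (\<lambda>i. case i of 0 \<Rightarrow> Re k | Suc i \<Rightarrow> d i)"
  have D': "real_diag (Suc n) d' = four_block_mat (real_diag 1 (\<lambda>_. Re k)) (0\<^sub>m 1 n) (0\<^sub>m n 1) (real_diag n d)"
    by (rule eq_matI) (auto simp: d'_def split: nat.split)
  have "unitary_diag (Suc n) F d' = four_block_mat (real_diag 1 (\<lambda>_. Re k)) (0\<^sub>m 1 n) (0\<^sub>m n 1) A3"
    unfolding unitary_diag_def F' D' A3eq unfolding F_def using vv
    by (subst mult_four_block_mat[where ?nr1.0=1 and ?n1.0=1 and ?nr2.0=n and ?n2.0=n and ?nc1.0=1 and ?nc2.0=n],
        auto simp: square_mat_closed[where n=n])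
       (subst mult_four_block_mat[where ?nr1.0=1 and ?n1.0=1 and ?nr2.0=n and ?n2.0=n and ?nc1.0=1 and ?nc2.0=n],
        auto simp: square_mat_closed[where n=n])
  also have "\<dots> = A'"
  proof (rule eq_matI)
    fix i j assume ij: "i < dim_row A'" "j < dim_col A'"
    then show "four_block_mat (real_diag 1 (\<lambda>_. Re k)) (0\<^sub>m 1 n) (0\<^sub>m n 1) A3 $$ (i,j) = A' $$ (i,j)"
      using A' e0[of i] e0'[of j] kr by (cases i; cases j) (auto simp: A3_def)
  qed (use A' A3 in auto)
  finally have "A' = unitary_diag (Suc n) F d'" ..
  moreover have "A = W * A' * mat_adjoint W"
    unfolding A'_def using w Suc.prems
    by (simp add: square_mat_assoc[where n="Suc n"] square_mat_closed[where n="Suc n"] cancel_left_inverse[where A=W and B="mat_adjoint W" and n="Suc n"])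
  ultimately have "A = unitary_diag (Suc n) (W * F) d'" using unitary_conj_unitary_diag[OF F W] by simp
  then show ?case using unitary_mats_mult[OF W F] by blast
qed

section \<open>Congruences, sums and traces of positive matrices\<close>

lemma cscalar_prod_congruence:
  fixes A C :: "complex mat"
  assumes A: "A \<in> carrier_mat n n" and C: "C \<in> carrier_mat n n" and v: "v \<in> carrier_vec n"
  shows "((mat_adjoint C * A * C) *\<^sub>v v) \<bullet>c v = (A *\<^sub>v (C *\<^sub>v v)) \<bullet>c (C *\<^sub>v v)"
proof -
  have Cv: "C *\<^sub>v v \<in> carrier_vec n" using C v by (rule mult_mat_vec_carrier)
  have ACv: "A *\<^sub>v (C *\<^sub>v v) \<in> carrier_vec n" using A Cv by (rule mult_mat_vec_carrier)
  have "(mat_adjoint C * A * C) *\<^sub>v v = mat_adjoint C *\<^sub>v (A *\<^sub>v (C *\<^sub>v v))"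
    using A C v Cv by (simp add: assoc_mult_mat_vec[of _ n n _ n] square_mat_closed[where n=n])
  then show ?thesis
    using adjoint_cscalar_prod[of "mat_adjoint C" n n "A *\<^sub>v (C *\<^sub>v v)" v] C v ACv by simp
qed

lemma cscalar_prod_add_mat:
  fixes A B :: "complex mat"
  assumes "A \<in> carrier_mat n n" "B \<in> carrier_mat n n" "v \<in> carrier_vec n"
  shows "((A + B) *\<^sub>v v) \<bullet>c v = (A *\<^sub>v v) \<bullet>c v + (B *\<^sub>v v) \<bullet>c v"
  using assms
  by (simp add: add_mult_distrib_mat_vec[of _ n n] add_scalar_prod_distrib[of _ n] mult_mat_vec_carrier[of _ n n])

lemma psd_congruence:
  assumes A: "A \<in> psd_mats n" and C: "C \<in> carrier_mat n n"
  shows "mat_adjoint C * A * C \<in> psd_mats n"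
proof (rule psd_matsI)
  note a = psd_matsD[OF A]
  show "mat_adjoint C * A * C \<in> carrier_mat n n" using a(1) C by auto
  show "mat_adjoint (mat_adjoint C * A * C) = mat_adjoint C * A * C"
    using a(1,2) C by (simp add: mat_adjoint_mult[where m=n and k=n and n=n] square_mat_assoc[where n=n] square_mat_closed[where n=n])
  fix v :: "complex vec" assume v: "v \<in> carrier_vec n"
  have Cv: "C *\<^sub>v v \<in> carrier_vec n" using C v by (rule mult_mat_vec_carrier)
  show "0 \<le> Re (((mat_adjoint C * A * C) *\<^sub>v v) \<bullet>c v)"
    using a(3)[OF Cv] unfolding cscalar_prod_congruence[OF a(1) C v] .
qed

lemma psd_congruence_hermitian:
  assumes "A \<in> psd_mats n" "C \<in> carrier_mat n n" "mat_adjoint C = C"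
  shows "C * A * C \<in> psd_mats n"
  using psd_congruence[OF assms(1,2)] assms(3) by simp

lemma psd_add:
  assumes "A \<in> psd_mats n" "B \<in> psd_mats n"
  shows "A + B \<in> psd_mats n"
proof (rule psd_matsI)
  note a = psd_matsD[OF assms(1)] psd_matsD[OF assms(2)]
  show "A + B \<in> carrier_mat n n" "mat_adjoint (A + B) = A + B" using a(1,2,4,5)
    by (auto simp: mat_adjoint_add[where m=n and n=n])
  fix v :: "complex vec" assume v: "v \<in> carrier_vec n"
  show "0 \<le> Re (((A + B) *\<^sub>v v) \<bullet>c v)"
    unfolding cscalar_prod_add_mat[OF a(1,4) v] using a(3,6)[OF v] by simp
qed

lemma psd_spectral:
  assumes "A \<in> psd_mats n"
  obtains U d where "U \<in> unitary_mats n" "A = unitary_diag n U d" "\<And>i. i < n \<Longrightarrow> 0 \<le> d i"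
  using hermitian_spectral[OF psd_matsD(1,2)[OF assms]] unitary_diag_psd_iff assms by blast

lemma psd_smult:
  assumes "A \<in> psd_mats n" "0 \<le> c"
  shows "complex_of_real c \<cdot>\<^sub>m A \<in> psd_mats n"
proof -
  obtain U d where U: "U \<in> unitary_mats n" and A: "A = unitary_diag n U d" "\<And>i. i < n \<Longrightarrow> 0 \<le> d i"
    using psd_spectral[OF assms(1)] by blast
  then show ?thesis using assms(2) by (simp add: unitary_diag_smult[OF U] unitary_diag_psd_iff[OF U])
qed

lemma pd_spectral:
  assumes "A \<in> pd_mats n"
  obtains U d where "U \<in> unitary_mats n" "A = unitary_diag n U d" "\<And>i. i < n \<Longrightarrow> 0 < d i"
  using hermitian_spectral[OF pd_matsD(1,2)[OF assms]] unitary_diag_pd_iff assms by blast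

lemma psd_root_exists:
  assumes "A \<in> psd_mats n"
  obtains R where "R \<in> psd_mats n" "R * R = A"
proof -
  obtain U d where U: "U \<in> unitary_mats n" and A: "A = unitary_diag n U d" "\<And>i. i < n \<Longrightarrow> 0 \<le> d i"
    using psd_spectral[OF assms] by blast
  have "unitary_diag n U (\<lambda>i. sqrt (d i)) * unitary_diag n U (\<lambda>i. sqrt (d i)) = A"
    unfolding unitary_diag_mult[OF U] A using A(2) by (intro unitary_diag_cong) auto
  then show thesis using that[of "unitary_diag n U (\<lambda>i. sqrt (d i))"] unitary_diag_psd_iff[OF U] A(2) by auto
qed

lemma pd_root_exists:
  assumes "A \<in> pd_mats n"
  obtains R where "R \<in> pd_mats n" "R * R = A"
proof -
  obtain U d where U: "U \<in> unitary_mats n" and A: "A = unitary_diag n U d" "\<And>i. i < n \<Longrightarrow> 0 < d i"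
    using pd_spectral[OF assms] by blast
  have "unitary_diag n U (\<lambda>i. sqrt (d i)) * unitary_diag n U (\<lambda>i. sqrt (d i)) = A"
    unfolding unitary_diag_mult[OF U] A using A(2) by (intro unitary_diag_cong) (auto simp: less_imp_le)
  then show thesis using that[of "unitary_diag n U (\<lambda>i. sqrt (d i))"] unitary_diag_pd_iff[OF U] A(2) by auto
qed

lemma pd_inverse_exists:
  assumes "A \<in> pd_mats n"
  obtains B where "B \<in> pd_mats n" "A * B = 1\<^sub>m n" "B * A = 1\<^sub>m n"
proof -
  obtain U d where U: "U \<in> unitary_mats n" and A: "A = unitary_diag n U d" "\<And>i. i < n \<Longrightarrow> 0 < d i"
    using pd_spectral[OF assms] by blast
  have "unitary_diag n U (\<lambda>i. d i * inverse (d i)) = unitary_diag n U (\<lambda>_. 1)" "unitary_diag n U (\<lambda>i. inverse (d i) * d i) = unitary_diag n U (\<lambda>_. 1)"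
    using A(2) by (intro unitary_diag_cong; force)+
  then have "A * unitary_diag n U (\<lambda>i. inverse (d i)) = 1\<^sub>m n" "unitary_diag n U (\<lambda>i. inverse (d i)) * A = 1\<^sub>m n"
    unfolding A unitary_diag_mult[OF U] unitary_diag_one[OF U] by simp_all
  then show thesis using that[of "unitary_diag n U (\<lambda>i. inverse (d i))"] unitary_diag_pd_iff[OF U] A(2) by auto
qed

lemma one_psd: "1\<^sub>m n \<in> psd_mats n"
proof -
  have "1\<^sub>m n \<in> unitary_mats n" by (rule unitary_matsI) auto
  from unitary_diag_psd_iff[OF this, of "\<lambda>_. 1"] unitary_diag_one[OF this] show ?thesis by simp
qed

lemma hermitian_square_psd:
  assumes "C \<in> carrier_mat n n" "mat_adjoint C = C"
  shows "C * C \<in> psd_mats n"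
  using psd_congruence_hermitian[OF one_psd assms] assms(1) by simp

lemma diag_entry_form:
  assumes "A \<in> carrier_mat n n" "i < n"
  shows "(A *\<^sub>v unit_vec n i) \<bullet>c unit_vec n i = (A :: complex mat) $$ (i,i)"
proof -
  have "conjugate (unit_vec n i) = (unit_vec n i :: complex vec)" by (rule eq_vecI) (auto simp: unit_vec_def)
  then show ?thesis using assms by simp
qed

lemma psd_diag_nonneg:
  assumes "A \<in> psd_mats n" "i < n"
  shows "0 \<le> Re (A $$ (i,i))"
  using psd_matsD(3)[OF assms(1), of "unit_vec n i"] diag_entry_form[OF psd_matsD(1)[OF assms(1)] assms(2)] by simp

lemma pd_congruence:
  assumes A: "A \<in> pd_mats n" and C: "C \<in> carrier_mat n n" "C' \<in> carrier_mat n n" "C' * C = 1\<^sub>m n"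
  shows "mat_adjoint C * A * C \<in> pd_mats n"
proof (rule pd_matsI)
  note a = pd_matsD[OF A]
  show "mat_adjoint C * A * C \<in> psd_mats n" using psd_congruence[OF pd_mats_psd[OF A] C(1)] .
  fix v :: "complex vec" assume v: "v \<in> carrier_vec n" "v \<noteq> 0\<^sub>v n"
  have Cv: "C *\<^sub>v v \<in> carrier_vec n" using C(1) v(1) by (rule mult_mat_vec_carrier)
  have "C' *\<^sub>v (C *\<^sub>v v) = v" using C v(1) by (simp flip: assoc_mult_mat_vec[of C' n n C n v])
  moreover have "C' *\<^sub>v 0\<^sub>v n = 0\<^sub>v n" using C(2) by (intro eq_vecI) auto
  ultimately have nz: "C *\<^sub>v v \<noteq> 0\<^sub>v n" using v(2) by auto
  show "Re (((mat_adjoint C * A * C) *\<^sub>v v) \<bullet>c v) \<noteq> 0"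
    using a(3)[OF Cv nz] unfolding cscalar_prod_congruence[OF a(1) C(1) v(1)] by simp
qed

lemma pd_add_psd:
  assumes "A \<in> pd_mats n" "B \<in> psd_mats n"
  shows "A + B \<in> pd_mats n"
proof (rule pd_matsI)
  show "A + B \<in> psd_mats n" using psd_add[OF pd_mats_psd[OF assms(1)] assms(2)] .
  fix v :: "complex vec" assume v: "v \<in> carrier_vec n" "v \<noteq> 0\<^sub>v n"
  show "Re (((A + B) *\<^sub>v v) \<bullet>c v) \<noteq> 0"
    unfolding cscalar_prod_add_mat[OF pd_matsD(1)[OF assms(1)] psd_matsD(1)[OF assms(2)] v(1)]
    using pd_matsD(3)[OF assms(1) v] psd_matsD(3)[OF assms(2) v(1)] by simp
qed

lemma pd_smult:
  assumes "A \<in> pd_mats n" "0 < c"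
  shows "complex_of_real c \<cdot>\<^sub>m A \<in> pd_mats n"
proof -
  obtain U d where U: "U \<in> unitary_mats n" and A: "A = unitary_diag n U d" "\<And>i. i < n \<Longrightarrow> 0 < d i"
    using pd_spectral[OF assms(1)] by blast
  then show ?thesis using assms(2) by (simp add: unitary_diag_smult[OF U] unitary_diag_pd_iff[OF U])
qed

lemma pd_diag_pos:
  assumes "A \<in> pd_mats n" "i < n"
  shows "0 < Re (A $$ (i,i))"
proof -
  have "unit_vec n i \<noteq> (0\<^sub>v n :: complex vec)"
    using assms(2) index_unit_vec(1)[of i n i] by (metis index_zero_vec(1) zero_neq_one)
  then show ?thesis
    using pd_matsD(3)[OF assms(1), of "unit_vec n i"] diag_entry_form[OF pd_matsD(1)[OF assms(1)] assms(2)] by simp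
qed

lemma mat_trace_psd_nonneg: "A \<in> psd_mats n \<Longrightarrow> 0 \<le> Re (mat_trace A)"
  using psd_diag_nonneg psd_matsD(1) by (fastforce simp: mat_trace_def intro!: sum_nonneg)

text \<open>With \<open>A = R R\<close> the trace is that of \<open>R B R\<close>.\<close>

lemma mat_trace_psd_mult_nonneg:
  assumes A: "A \<in> psd_mats n" and B: "B \<in> psd_mats n"
  shows "0 \<le> Re (mat_trace (A * B))"
proof -
  obtain R where R: "R \<in> psd_mats n" "R * R = A" using psd_root_exists[OF A] .
  note r = psd_matsD(1,2)[OF R(1)] and b = psd_matsD(1,2)[OF B]
  have "mat_trace (A * B) = mat_trace (R * (R * B))" using R(2) r b by (simp flip: assoc_mult_mat[of R n n R n B n])
  also have "\<dots> = mat_trace (R * B * R)" using r b by (intro mat_trace_comm) auto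
  finally show ?thesis using mat_trace_psd_nonneg[OF psd_congruence_hermitian[OF B r]] by simp
qed

text \<open>Operator monotonicity of the square root. Put \<open>K = T - H\<close>, so that
  \<open>T^2 - H^2 = T K + K T - K^2\<close>. In an orthonormal eigenbasis of \<open>K\<close>, with eigenvalues \<open>d i\<close>, the diagonal
  entries of this matrix are \<open>2 (d i) (t i) - (d i)^2\<close> with the diagonal entries \<open>t i > 0\<close> of \<open>T\<close>; hence
  they are nonnegative only if \<open>d i \<ge> 0\<close>.\<close>

lemma psd_le_of_square_le:
  assumes T: "T \<in> pd_mats n" and H: "H \<in> carrier_mat n n" "mat_adjoint H = H"
    and le: "T * T - H * H \<in> psd_mats n"
  shows "T - H \<in> psd_mats n"
proof -
  note t = pd_matsD(1,2)[OF T]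
  have "T - H \<in> carrier_mat n n" "mat_adjoint (T - H) = T - H"
    using t H by (auto simp: mat_adjoint_minus[where m=n and n=n])
  from hermitian_spectral[OF this] obtain U d where U: "U \<in> unitary_mats n" and K: "T - H = unitary_diag n U d" by blast
  note u = unitary_matsD[OF U]
  define T' where "T' = mat_adjoint U * T * U"
  define D where "D = real_diag n d"
  have D: "D \<in> carrier_mat n n" unfolding D_def by simp
  have H_eq: "H = T - U * D * mat_adjoint U"
    using t H K[unfolded unitary_diag_def] D unfolding D_def by (intro eq_matI) (auto simp flip: K[unfolded unitary_diag_def])
  have T': "T' \<in> carrier_mat n n" unfolding T'_def using t u by auto
  have "mat_adjoint U * (T * T - H * H) * U = T' * D + D * T' - D * D"
    unfolding H_eq T'_def using t u D
    by (simp add: square_mat_assoc[where n=n] square_mat_closed[where n=n] square_mat_distribs[where n=n]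
        cancel_left_inverse[where A="mat_adjoint U" and B=U and n=n] cancel_left_inverse[where A=U and B="mat_adjoint U" and n=n])
       (intro eq_matI, auto)
  with psd_congruence[OF le u(1)] have psd: "T' * D + D * T' - D * D \<in> psd_mats n" by simp
  have T'pd: "T' \<in> pd_mats n" unfolding T'_def by (rule pd_congruence[OF T u(1,2,3)])
  have "0 \<le> d i" if i: "i < n" for i
  proof (rule ccontr)
    assume neg: "\<not> 0 \<le> d i"
    have "(T' * D) $$ (i,i) = T' $$ (i,i) * complex_of_real (d i)" "(D * T') $$ (i,i) = complex_of_real (d i) * T' $$ (i,i)"
      using i T' by (simp_all add: D_def scalar_prod_def if_distrib[where f="\<lambda>x. x * _"] if_distrib[where f="\<lambda>x. _ * x"] cong: if_cong)
    moreover have "(D * D) $$ (i,i) = complex_of_real (d i * d i)" using i unfolding D_def real_diag_mult by simp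
    ultimately have "(T' * D + D * T' - D * D) $$ (i,i) = 2 * complex_of_real (d i) * T' $$ (i,i) - complex_of_real (d i * d i)"
      using i T' D by simp
    then have "0 \<le> 2 * d i * Re (T' $$ (i,i)) - d i * d i" using psd_diag_nonneg[OF psd i] by simp
    moreover have "d i * Re (T' $$ (i,i)) < 0" using neg pd_diag_pos[OF T'pd i] by (simp add: mult_neg_pos)
    moreover have "0 \<le> d i * d i" by simp
    ultimately show False by linarith
  qed
  then show ?thesis unfolding K unitary_diag_psd_iff[OF U] by blast
qed

section \<open>Square roots, inverses and the geometric mean\<close>

text \<open>Operator monotonicity of the square root, applied to \<open>R^2 \<le> T^2\<close> and to \<open>T^2 \<le> R^2\<close>, gives \<open>R \<le> T \<le> R\<close>;
  \<open>R\<close> is definite because its square is.\<close>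

lemma pd_root_unique:
  assumes T: "T \<in> pd_mats n" and R: "R \<in> psd_mats n" and eq: "R * R = T * T"
  shows "R = T"
proof -
  obtain V e where V: "V \<in> unitary_mats n" and e: "R = unitary_diag n V e" "\<And>i. i < n \<Longrightarrow> 0 \<le> e i"
    using psd_spectral[OF R] by blast
  note t = pd_matsD(1,2)[OF T] and r = psd_matsD(1,2)[OF R]
  have "T * T \<in> pd_mats n"
  proof -
    obtain U d where U: "U \<in> unitary_mats n" "T = unitary_diag n U d" "\<And>i. i < n \<Longrightarrow> 0 < d i"
      using pd_spectral[OF T] by blast
    then show ?thesis by (simp add: unitary_diag_mult unitary_diag_pd_iff)
  qed
  then have "\<forall>i<n. 0 < e i * e i" unfolding eq[symmetric] e unitary_diag_mult[OF V] unitary_diag_pd_iff[OF V] .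
  then have "\<forall>i<n. 0 < e i" using e(2) by (metis mult_zero_left order.order_iff_strict)
  then have Rpd: "R \<in> pd_mats n" unfolding e unitary_diag_pd_iff[OF V] .
  have z: "R * R - T * T \<in> psd_mats n" "T * T - R * R \<in> psd_mats n"
  proof -
    have "R * R - T * T = complex_of_real 0 \<cdot>\<^sub>m 1\<^sub>m n" "T * T - R * R = complex_of_real 0 \<cdot>\<^sub>m 1\<^sub>m n"
      using t r by (auto simp: eq intro!: eq_matI)
    then show "R * R - T * T \<in> psd_mats n" "T * T - R * R \<in> psd_mats n" using psd_smult[OF one_psd, of 0 n] by simp_all
  qed
  have 1: "T - R \<in> psd_mats n" by (rule psd_le_of_square_le[OF T r z(2)])
  have 2: "R - T \<in> psd_mats n" by (rule psd_le_of_square_le[OF Rpd t z(1)])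
  obtain U d where U: "U \<in> unitary_mats n" "T - R = unitary_diag n U d" "\<And>i. i < n \<Longrightarrow> 0 \<le> d i"
    using psd_spectral[OF 1] by blast
  have "R - T = complex_of_real (-1) \<cdot>\<^sub>m (T - R)" using t r by (intro eq_matI) auto
  then have "unitary_diag n U (\<lambda>i. - 1 * d i) \<in> psd_mats n" using 2 unfolding U(2) unitary_diag_smult[OF U(1)] by simp
  then have "d i = 0" if "i < n" for i using that U(3)[OF that] unfolding unitary_diag_psd_iff[OF U(1)] by force
  then have "T - R = unitary_diag n U (\<lambda>_. 0 * 1)" unfolding U(2) by (intro unitary_diag_cong) simp
  also have "\<dots> = complex_of_real 0 \<cdot>\<^sub>m 1\<^sub>m n" unfolding unitary_diag_smult[OF U(1), symmetric] unitary_diag_one[OF U(1)] by simp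
  finally have *: "T - R = 0\<^sub>m n n" by (auto intro!: eq_matI)
  show ?thesis
  proof (rule eq_matI)
    fix i j assume "i < dim_row T" "j < dim_col T"
    then show "R $$ (i,j) = T $$ (i,j)" using arg_cong[OF *, of "\<lambda>M. M $$ (i,j)"] t r by auto
  qed (use t r in auto)
qed

lemma mat_sqrt_pd:
  assumes P: "P \<in> pd_mats n"
  shows "mat_sqrt P \<in> pd_mats n" "mat_sqrt P * mat_sqrt P = P"
proof -
  obtain T where T: "T \<in> pd_mats n" "T * T = P" using pd_root_exists[OF P] by blast
  have "dim_row P = n" using pd_matsD(1)[OF P] by simp
  then have "mat_sqrt P = T"
    unfolding mat_sqrt_def
  proof (simp only:, intro the_equality conjI)
    show "T \<in> psd_mats n" "T * T = P" using pd_mats_psd[OF T(1)] T(2) by simp_all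
    fix R assume "R \<in> psd_mats n \<and> R * R = P"
    then show "R = T" using T(2) by (intro pd_root_unique[OF T(1)]) simp_all
  qed
  then show "mat_sqrt P \<in> pd_mats n" "mat_sqrt P * mat_sqrt P = P" using T by simp_all
qed

lemma mat_inv_pd:
  assumes P: "P \<in> pd_mats n"
  shows "mat_inv P \<in> pd_mats n" "P * mat_inv P = 1\<^sub>m n" "mat_inv P * P = 1\<^sub>m n"
proof -
  obtain B where B: "B \<in> pd_mats n" "P * B = 1\<^sub>m n" "B * P = 1\<^sub>m n" using pd_inverse_exists[OF P] by blast
  note c = pd_matsD(1)[OF P] pd_matsD(1)[OF B(1)]
  have "P \<in> Units (ring_mat TYPE(complex) n ())"
    unfolding Units_def ring_mat_simps using B c by auto
  then obtain C where C: "mat_inverse P = Some C" using mat_inverse(1)[OF c(1), where b="()"] by (cases "mat_inverse P") auto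
  from mat_inverse(2)[OF c(1) C] have cc: "P * C = 1\<^sub>m n" "C * P = 1\<^sub>m n" "C \<in> carrier_mat n n" by auto
  have "C = C * (P * B)" using cc B by simp
  also have "\<dots> = B" using cancel_left_inverse[OF cc(2) cc(3) c] .
  finally show "mat_inv P \<in> pd_mats n" "P * mat_inv P = 1\<^sub>m n" "mat_inv P * P = 1\<^sub>m n"
    using B C unfolding mat_inv_def by simp_all
qed

text \<open>The last equation expresses the symmetry of the geometric mean in its arguments. It follows from
  the second one, which exhibits \<open>A^-1 G B^-1\<close> as a right inverse of \<open>G\<close>, hence as a left inverse.\<close>

lemma geo_mean_riccati:
  assumes A: "A \<in> pd_mats n" and B: "B \<in> pd_mats n"
  shows "geo_mean A B \<in> pd_mats n"
    "geo_mean A B * (mat_inv (mat_sqrt A) * mat_inv (mat_sqrt A)) * geo_mean A B = B"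
    "geo_mean A B * (mat_inv (mat_sqrt B) * mat_inv (mat_sqrt B)) * geo_mean A B = A"
proof -
  define P where "P = mat_sqrt A"
  define Pinv where "Pinv = mat_inv P"
  define Q where "Q = mat_sqrt B"
  define Qinv where "Qinv = mat_inv Q"
  define Z where "Z = mat_sqrt (Pinv * B * Pinv)"
  define G where "G = P * Z * P"
  have P: "P \<in> pd_mats n" "P * P = A" unfolding P_def using mat_sqrt_pd[OF A] by auto
  have Q: "Q \<in> pd_mats n" "Q * Q = B" unfolding Q_def using mat_sqrt_pd[OF B] by auto
  note Pinv = mat_inv_pd[OF P(1), folded Pinv_def] and Qinv = mat_inv_pd[OF Q(1), folded Qinv_def]
  note carr = pd_matsD(1)[OF P(1)] pd_matsD(1)[OF Pinv(1)] pd_matsD(1)[OF Q(1)] pd_matsD(1)[OF Qinv(1)] pd_matsD(1)[OF B]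
  note herm = pd_matsD(2)[OF P(1)] pd_matsD(2)[OF Pinv(1)]
  have "Pinv * B * Pinv \<in> pd_mats n" using pd_congruence[OF B carr(2) carr(1) Pinv(2)] herm by simp
  from mat_sqrt_pd[OF this, folded Z_def] have Z: "Z \<in> pd_mats n" "Z * Z = Pinv * B * Pinv" .
  note z = pd_matsD(1)[OF Z(1)]
  note cl = square_mat_closed[where n=n] and sa = square_mat_assoc[where n=n]
  note canc = cancel_left_inverse[where A=P and B=Pinv and n=n, OF Pinv(2) carr(1,2)]
    cancel_left_inverse[where A=Pinv and B=P and n=n, OF Pinv(3) carr(2,1)]
    cancel_left_inverse[where A=Q and B=Qinv and n=n, OF Qinv(2) carr(3,4)]
  have G: "G \<in> pd_mats n" unfolding G_def using pd_congruence[OF Z(1) carr(1,2) Pinv(3)] herm by simp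
  note g = pd_matsD(1)[OF G]
  have "G * (Pinv * Pinv) * G = P * (Z * Z) * P" unfolding G_def using carr z by (simp add: cl sa canc)
  also have "\<dots> = B" unfolding Z(2) using carr by (simp add: cl sa canc Pinv)
  finally have 1: "G * (Pinv * Pinv) * G = B" .
  have GM: "geo_mean A B = G" unfolding geo_mean_def G_def Z_def Pinv_def P_def ..
  have "G * ((Pinv * Pinv) * G * (Qinv * Qinv)) = (G * (Pinv * Pinv) * G) * (Qinv * Qinv)"
    using carr g by (simp add: cl sa)
  also have "\<dots> = 1\<^sub>m n" unfolding 1 Q(2)[symmetric] using carr by (simp add: cl sa canc Qinv)
  finally have "G * ((Pinv * Pinv) * G * (Qinv * Qinv)) = 1\<^sub>m n" .
  from mat_mult_left_right_inverse[OF g _ this] have "((Pinv * Pinv) * G * (Qinv * Qinv)) * G = 1\<^sub>m n"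
    using g carr by (simp add: cl)
  then have "P * P * (((Pinv * Pinv) * G * (Qinv * Qinv)) * G) = P * P * 1\<^sub>m n" by simp
  then have "G * (Qinv * Qinv) * G = P * P" using carr g by (simp add: cl sa canc)
  then have "G * (Qinv * Qinv) * G = A" unfolding P(2) .
  then show "geo_mean A B \<in> pd_mats n"
    "geo_mean A B * (mat_inv (mat_sqrt A) * mat_inv (mat_sqrt A)) * geo_mean A B = B"
    "geo_mean A B * (mat_inv (mat_sqrt B) * mat_inv (mat_sqrt B)) * geo_mean A B = A"
    using G 1 GM unfolding Qinv_def Q_def Pinv_def P_def by simp_all
qed

text \<open>If \<open>G\<close> solves the Riccati equation for \<open>P^2\<close> and \<open>B\<close>, then \<open>X\<close> solves the one for \<open>P^2\<close> and the
  right side. This is what makes the power mean comparable with geometric means.\<close>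

lemma riccati_shift:
  fixes a b :: real
  assumes P: "P \<in> carrier_mat n n" "Pinv \<in> carrier_mat n n" "P * Pinv = 1\<^sub>m n" "Pinv * P = 1\<^sub>m n"
    and G: "G \<in> carrier_mat n n" "G * (Pinv * Pinv) * G = B" and B: "B \<in> carrier_mat n n"
  defines "X \<equiv> complex_of_real a \<cdot>\<^sub>m (P * P) + complex_of_real b \<cdot>\<^sub>m G"
  shows "X * (Pinv * Pinv) * X = complex_of_real (a^2) \<cdot>\<^sub>m (P * P) + complex_of_real (b^2) \<cdot>\<^sub>m B
              + complex_of_real (2 * a * b) \<cdot>\<^sub>m G"
proof -
  have G': "G * (Pinv * (Pinv * G)) = B" using G P(2) by (simp add: square_mat_assoc[where n=n] square_mat_closed[where n=n])
  have "X * (Pinv * Pinv) * X = (complex_of_real a * complex_of_real a) \<cdot>\<^sub>m (P * P) + (complex_of_real a * complex_of_real b) \<cdot>\<^sub>m G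
     + ((complex_of_real b * complex_of_real a) \<cdot>\<^sub>m G + (complex_of_real b * complex_of_real b) \<cdot>\<^sub>m B)"
    unfolding X_def using P G(1) B
    by (simp add: square_mat_assoc[where n=n] square_mat_closed[where n=n] square_mat_distribs[where n=n] smult_smult_mat G'
         add_smult_distrib_left_mat[of _ n n] mult.commute
       cancel_left_inverse[where A=P and B=Pinv and n=n] cancel_left_inverse[where A=Pinv and B=P and n=n])
  also have "\<dots> = complex_of_real (a^2) \<cdot>\<^sub>m (P * P) + complex_of_real (b^2) \<cdot>\<^sub>m B
              + complex_of_real (2 * a * b) \<cdot>\<^sub>m G"
    using P(1) G(1) B by (intro eq_matI) (auto simp: power2_eq_square algebra_simps simp del: index_mult_mat(1))
  finally show ?thesis .
qed

section \<open>Decreasing eigenvalues and the Ky Fan principle\<close>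

text \<open>The projection onto the span of the first \<open>k\<close> columns of \<open>U\<close>; a spectral projection for the \<open>k\<close>
  largest eigenvalues when the eigenvalues are listed in decreasing order.\<close>

definition top_proj :: "nat \<Rightarrow> complex mat \<Rightarrow> nat \<Rightarrow> complex mat" where
  "top_proj n U k = unitary_diag n U (\<lambda>i. if i < k then 1 else 0)"

lemma sum_if_less:
  fixes k n :: nat
  assumes "k \<le> n"
  shows "(\<Sum>i<n. if i < k then f i else (0::real)) = (\<Sum>i<k. f i)"
  using assms by (intro sum.mono_neutral_cong_right) auto

lemma mat_trace_top_proj_unitary_diag:
  assumes U: "U \<in> unitary_mats n" and k: "k \<le> n"
  shows "Re (mat_trace (top_proj n U k * unitary_diag n U d)) = (\<Sum>i<k. d i)"
proof -
  have "top_proj n U k * unitary_diag n U d = unitary_diag n U (\<lambda>i. if i < k then d i else 0)"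
    unfolding top_proj_def unitary_diag_mult[OF U] by (rule unitary_diag_cong) simp
  then show ?thesis using sum_if_less[OF k, of d] by (simp add: mat_trace_unitary_diag[OF U])
qed

lemma top_proj_complement:
  assumes U: "U \<in> unitary_mats n"
  shows "top_proj n U k \<in> psd_mats n" "1\<^sub>m n - top_proj n U k \<in> psd_mats n"
proof -
  show "top_proj n U k \<in> psd_mats n" unfolding top_proj_def unitary_diag_psd_iff[OF U] by simp
  show "1\<^sub>m n - top_proj n U k \<in> psd_mats n"
    unfolding top_proj_def unitary_diag_one[OF U, symmetric] unitary_diag_minus[OF U] unitary_diag_psd_iff[OF U] by simp
qed

text \<open>Split \<open>T = \<mu> 1 + K - L\<close> at the \<open>k\<close>-th eigenvalue \<open>\<mu>\<close>, with \<open>K\<close> and \<open>L\<close> the positive parts of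
  \<open>T - \<mu> 1\<close> and \<open>\<mu> 1 - T\<close>. A projection \<open>E\<close> of rank \<open>k\<close> satisfies \<open>tr E = k\<close>, \<open>tr E L \<ge> 0\<close> and
  \<open>tr E K \<le> tr K\<close>, and \<open>k \<mu> + tr K\<close> is the sum of the \<open>k\<close> largest eigenvalues.\<close>

lemma ky_fan:
  assumes U: "U \<in> unitary_mats n" and V: "V \<in> unitary_mats n" and k: "1 \<le> k" "k \<le> n"
    and t: "antimono_on {..<n} t"
  shows "Re (mat_trace (top_proj n V k * unitary_diag n U t)) \<le> (\<Sum>i<k. t i)"
proof -
  define \<mu> where "\<mu> = t (k - 1)"
  define E where "E = top_proj n V k"
  define K where "K = unitary_diag n U (\<lambda>i. if i < k then t i - \<mu> else 0)"
  define L where "L = unitary_diag n U (\<lambda>i. if i < k then 0 else \<mu> - t i)"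
  have E: "E \<in> psd_mats n" "1\<^sub>m n - E \<in> psd_mats n" unfolding E_def using top_proj_complement[OF V] by auto
  have K: "K \<in> psd_mats n" unfolding K_def unitary_diag_psd_iff[OF U] \<mu>_def using monotone_onD[OF t] k by auto
  have L: "L \<in> psd_mats n" unfolding L_def unitary_diag_psd_iff[OF U] \<mu>_def using monotone_onD[OF t] k by auto
  note c = psd_matsD(1)[OF E(1)] psd_matsD(1)[OF K] psd_matsD(1)[OF L]
  have T: "unitary_diag n U t = complex_of_real \<mu> \<cdot>\<^sub>m 1\<^sub>m n + K - L"
    unfolding K_def L_def unitary_diag_one[OF U, symmetric] unitary_diag_smult[OF U] unitary_diag_add[OF U] unitary_diag_minus[OF U]
    by (rule unitary_diag_cong) auto
  have "Re (mat_trace (E * unitary_diag n U t)) = \<mu> * Re (mat_trace E) + Re (mat_trace (E * K)) - Re (mat_trace (E * L))"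
    unfolding T using c by (simp add: square_mat_distribs[where n=n] square_mat_closed[where n=n] mat_trace_add[where n=n] mat_trace_minus[where n=n] mat_trace_smult[where n=n])
  moreover have "Re (mat_trace E) = k"
    unfolding E_def top_proj_def using sum_if_less[OF k(2), of "\<lambda>_. 1"] by (simp add: mat_trace_unitary_diag[OF V])
  moreover have "0 \<le> Re (mat_trace (E * L))" using mat_trace_psd_mult_nonneg[OF E(1) L] .
  moreover have "Re (mat_trace (E * K)) \<le> Re (mat_trace K)"
    using mat_trace_psd_mult_nonneg[OF E(2) K] c by (simp add: square_mat_distribs[where n=n] square_mat_closed[where n=n] mat_trace_minus[where n=n])
  moreover have "Re (mat_trace K) = (\<Sum>i<k. t i - \<mu>)" unfolding K_def using sum_if_less[OF k(2)] by (simp add: mat_trace_unitary_diag[OF U])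
  ultimately show ?thesis unfolding E_def by (simp add: sum_subtractf algebra_simps)
qed

lemma eigvals_desc_unitary_diag:
  assumes U: "U \<in> unitary_mats n" and d: "antimono_on {..<n} d"
  shows "eigvals_desc (unitary_diag n U d) = map d [0..<n]"
proof -
  note u = unitary_matsD[OF U]
  have "similar_mat_wit (unitary_diag n U d) (real_diag n d) U (mat_adjoint U)"
    unfolding similar_mat_wit_def Let_def using u unitary_diag_carrier[OF U, of d] by (simp add: unitary_diag_def)
  then have "char_poly (unitary_diag n U d) = char_poly (real_diag n d)"
    by (intro char_poly_similar) (auto simp: similar_mat_def)
  also have "\<dots> = (\<Prod>a\<leftarrow>diag_mat (real_diag n d). [:- a, 1:])"
    by (rule char_poly_upper_triangular[where n=n]) (auto simp: upper_triangular_def)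
  also have "diag_mat (real_diag n d) = map (\<lambda>i. complex_of_real (d i)) [0..<n]"
    unfolding diag_mat_def by auto
  finally have cp: "char_poly (unitary_diag n U d) = (\<Prod>a\<leftarrow>map (\<lambda>i. complex_of_real (d i)) [0..<n]. [:- a, 1:])" .
  have pr: "proots (\<Prod>a\<leftarrow>xs. [:- a, 1:]) = mset xs" for xs :: "complex list"
  proof (induction xs)
    case (Cons a xs)
    have "(\<Prod>a\<leftarrow>xs. [:- a, 1:]) \<noteq> 0" by (auto simp: prod_list_zero_iff)
    then show ?case using Cons by (simp add: proots_mult del: mult_pCons_left)
  qed simp
  have "image_mset Re (proots (char_poly (unitary_diag n U d))) = mset (rev (map d [0..<n]))"
    unfolding cp pr by (simp add: image_mset.compositionality comp_def flip: mset_map)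
  then have "sorted_list_of_multiset (image_mset Re (proots (char_poly (unitary_diag n U d)))) = sort (rev (map d [0..<n]))"
    by (simp only: sorted_list_of_multiset_mset)
  also have "sorted (rev (map d [0..<n]))"
    using d by (auto simp: sorted_rev_iff_nth_mono monotone_on_def)
  then have "sort (rev (map d [0..<n])) = rev (map d [0..<n])" by (rule sorted_sort_id)
  finally show ?thesis unfolding eigvals_desc_def by simp
qed

text \<open>Permuting the columns of \<open>U\<close> permutes the eigenvalues.\<close>

lemma unitary_diag_permute:
  assumes U: "U \<in> unitary_mats n" and p: "p permutes {..<n}"
  shows "\<exists>V \<in> unitary_mats n. unitary_diag n U d = unitary_diag n V (\<lambda>i. d (p i))"
proof -
  note u = unitary_matsD[OF U]
  define V where "V = mat n n (\<lambda>(i,j). U $$ (i, p j))"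
  have pn: "p i < n" if "i < n" for i using permutes_in_image[OF p, of i] that by simp
  have V: "V \<in> carrier_mat n n" unfolding V_def by simp
  have "V \<in> unitary_mats n"
  proof (rule unitary_matsI[OF V], rule eq_matI)
    fix i j assume "i < dim_row (1\<^sub>m n :: complex mat)" "j < dim_col (1\<^sub>m n :: complex mat)"
    then have ij: "i < n" "j < n" by auto
    have "(mat_adjoint V * V) $$ (i,j) = (mat_adjoint U * U) $$ (p i, p j)"
      using ij pn u(1) by (simp add: V_def scalar_prod_def)
    also have "\<dots> = 1\<^sub>m n $$ (i,j)" unfolding u(3) using ij pn permutes_inj[OF p] by (auto simp: inj_eq)
    finally show "(mat_adjoint V * V) $$ (i,j) = 1\<^sub>m n $$ (i,j)" .
  qed (use V in auto)
  moreover have entry: "unitary_diag n W e $$ (i,j) = (\<Sum>k<n. W $$ (i,k) * e k * cnj (W $$ (j,k)))"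
    if W: "W \<in> carrier_mat n n" and ij: "i < n" "j < n" for W e i j
  proof -
    have "(W * real_diag n e) $$ (i,k) = W $$ (i,k) * e k" if "k < n" for k
      using W ij that by (simp add: scalar_prod_def if_distrib[where f="\<lambda>x. _ * x"] cong: if_cong)
    then show ?thesis unfolding unitary_diag_def using W ij
      by (subst index_mult_mat) (auto simp: scalar_prod_def[of "row (W * _) i"] lessThan_atLeast0 simp del: index_mult_mat(1))
  qed
  moreover have "unitary_diag n U d = unitary_diag n V (\<lambda>i. d (p i))"
  proof (rule eq_matI)
    fix i j assume "i < dim_row (unitary_diag n V (\<lambda>i. d (p i)))" "j < dim_col (unitary_diag n V (\<lambda>i. d (p i)))"
    then have ij: "i < n" "j < n" using V by (auto simp: unitary_diag_def)
    have "unitary_diag n V (\<lambda>i. d (p i)) $$ (i,j) = (\<Sum>k<n. U $$ (i, p k) * d (p k) * cnj (U $$ (j, p k)))"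
      unfolding entry[OF V ij] using ij by (simp add: V_def)
    also have "\<dots> = (\<Sum>k<n. U $$ (i, k) * d k * cnj (U $$ (j, k)))"
      using sum.permute[OF p, of "\<lambda>k. U $$ (i, k) * d k * cnj (U $$ (j, k))"] by (simp add: comp_def)
    also have "\<dots> = unitary_diag n U d $$ (i,j)" unfolding entry[OF u(1) ij] ..
    finally show "unitary_diag n U d $$ (i,j) = unitary_diag n V (\<lambda>i. d (p i)) $$ (i,j)" ..
  qed (use u V in \<open>auto simp: unitary_diag_def\<close>)
  ultimately show ?thesis by blast
qed

lemma hermitian_spectral_desc:
  assumes "A \<in> carrier_mat n n" "mat_adjoint A = A"
  obtains U d where "U \<in> unitary_mats n" "A = unitary_diag n U d" "antimono_on {..<n} d"
proof -
  obtain U d where U: "U \<in> unitary_mats n" "A = unitary_diag n U d" using hermitian_spectral[OF assms] by blast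
  define xs where "xs = rev (sort (map d [0..<n]))"
  have "mset xs = mset (map d [0..<n])" unfolding xs_def by simp
  then obtain p where p: "p permutes {..<length (map d [0..<n])}" "permute_list p (map d [0..<n]) = xs"
    by (rule mset_eq_permutation)
  then have pn: "p permutes {..<n}" by simp
  have len: "length xs = n" unfolding xs_def by simp
  have xs: "xs ! i = d (p i)" if "i < n" for i
    using permute_list_nth[OF p(1), of i] that p(2) permutes_in_image[OF pn, of i] by simp
  have "sorted (rev xs)" unfolding xs_def by simp
  then have "antimono_on {..<n} (\<lambda>i. d (p i))"
    using sorted_rev_nth_mono[of xs] len xs by (auto simp: monotone_on_def)
  then show thesis using unitary_diag_permute[OF U(1) pn, of d] U(2) that by blast
qed

lemma weakly_majorized_desc:
  assumes x: "antimono_on {..<n} x" and y: "antimono_on {..<n} y"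
    and le: "\<And>k. k \<le> n \<Longrightarrow> (\<Sum>i<k. x i) \<le> (\<Sum>i<k. y i)"
  shows "map x [0..<n] \<prec>\<^sub>w map y [0..<n]"
proof -
  have id: "decr_rearr (map z [0..<n]) = map z [0..<n]" if "antimono_on {..<n} z" for z
  proof -
    have "sorted (rev (map z [0..<n]))" using that by (auto simp: sorted_rev_iff_nth_mono monotone_on_def)
    then have "sort (rev (map z [0..<n])) = rev (map z [0..<n])" by (rule sorted_sort_id)
    moreover have "sort (rev (map z [0..<n])) = sort (map z [0..<n])" by (intro properties_for_sort) auto
    ultimately show ?thesis unfolding decr_rearr_def by simp
  qed
  have "(\<Sum>j<k. map z [0..<n] ! j) = (\<Sum>j<k. z j)" if "k \<le> n" for k and z :: "nat \<Rightarrow> real"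
    using that by (intro sum.cong) auto
  then show ?thesis unfolding weakly_majorized_def id[OF x] id[OF y] using le by simp
qed

section \<open>Comparing a geometric mean with a product of square roots\<close>

text \<open>The trace of the geometric mean of \<open>P^2\<close> and \<open>R^2\<close> is at most \<open>tr P R\<close>. Here \<open>G = P Y P\<close> is the mean.
  With \<open>D = P R^-1 P\<close> the equation for \<open>Y\<close> becomes \<open>D Y^2 D = P^2\<close>, and two squares suffice. First,
  \<open>tr Y (P - D Y)(P - Y D)\<close> is nonnegative, and since \<open>tr Y D Y^2 D = tr Y P^2 = tr G\<close> this says
  \<open>tr Y D Y P \<le> tr G\<close>. Second, with \<open>Z = 1 - P^-1 G R^-1\<close> the trace of \<open>P Z R Z^*\<close> is nonnegative, which
  says \<open>tr P R \<ge> 2 tr G - tr G R^-1 G P^-1\<close>; and \<open>tr G R^-1 G P^-1 = tr Y D Y P\<close>.\<close>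

lemma mat_trace_geo_mean_le:
  assumes P: "P \<in> psd_mats n" and R: "R \<in> psd_mats n" and Y: "Y \<in> psd_mats n"
    and Pinv: "Pinv \<in> psd_mats n" "P * Pinv = 1\<^sub>m n" "Pinv * P = 1\<^sub>m n"
    and Rinv: "Rinv \<in> psd_mats n" "R * Rinv = 1\<^sub>m n" "Rinv * R = 1\<^sub>m n"
    and YY: "Y * Y = Pinv * (R * R) * Pinv"
  shows "Re (mat_trace (P * Y * P)) \<le> Re (mat_trace (P * R))"
proof -
  note carr = psd_matsD(1)[OF P] psd_matsD(1)[OF R] psd_matsD(1)[OF Y] psd_matsD(1)[OF Pinv(1)] psd_matsD(1)[OF Rinv(1)]
  note herm = psd_matsD(2)[OF P] psd_matsD(2)[OF R] psd_matsD(2)[OF Y] psd_matsD(2)[OF Pinv(1)] psd_matsD(2)[OF Rinv(1)]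
  note cl = square_mat_closed[where n=n]
  note sa = square_mat_assoc[where n=n]
  note canc = cancel_left_inverse[where A=P and B=Pinv and n=n, OF Pinv(2) carr(1,4)]
    cancel_left_inverse[where A=Pinv and B=P and n=n, OF Pinv(3) carr(4,1)]
    cancel_left_inverse[where A=R and B=Rinv and n=n, OF Rinv(2) carr(2,5)]
    cancel_left_inverse[where A=Rinv and B=R and n=n, OF Rinv(3) carr(5,2)]
  note adj = mat_adjoint_mult[where m=n and k=n and n=n] mat_adjoint_minus[where m=n and n=n]
  define D where "D = P * (Rinv * P)"
  have D: "D \<in> carrier_mat n n" "mat_adjoint D = D"
    unfolding D_def using carr herm by (simp_all add: adj cl sa)
  have "D * (Y * Y) * D = P * P"
    unfolding YY unfolding D_def using carr by (simp add: cl sa canc Pinv Rinv)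
  then have DYYD: "D * (Y * (Y * D)) = P * P" using carr D by (simp add: cl sa)
  define t where "t = mat_trace (Y * (D * (Y * P)))"
  define g where "g = mat_trace (P * (Y * P))"
  have t': "mat_trace (P * (Y * (D * Y))) = t"
    unfolding t_def using carr D mat_trace_comm[of P n n "Y * (D * Y)"] by (simp add: cl sa)
  have g': "mat_trace (Y * (D * (Y * (D * Y)))) = g"
  proof -
    have "mat_trace (Y * (D * (Y * (D * Y)))) = mat_trace ((Y * D) * (Y * (D * Y)))" using carr D by (simp add: cl sa)
    also have "\<dots> = mat_trace ((Y * (D * Y)) * (Y * D))" using carr D by (intro mat_trace_comm[of _ n n]) (auto simp: cl)
    also have "(Y * (D * Y)) * (Y * D) = (Y * P) * P" using carr D DYYD by (simp add: cl sa)
    also have "mat_trace ((Y * P) * P) = g" unfolding g_def using carr by (intro mat_trace_comm[of _ n n]) (auto simp: cl)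
    finally show ?thesis .
  qed
  have "mat_adjoint (P - D * Y) = P - Y * D" using carr D herm by (simp add: adj cl)
  then have "(P - Y * D) * Y * (P - D * Y) \<in> psd_mats n"
    using psd_congruence[OF Y, of "P - D * Y"] carr D by (simp add: cl)
  from mat_trace_psd_nonneg[OF this] have s1: "0 \<le> Re (g - t - (t - g))"
    using carr D by (simp add: cl sa square_mat_distribs[where n=n] mat_trace_minus[where n=n] t' g' flip: g_def t_def)
  define G where "G = P * (Y * P)"
  have G: "G \<in> carrier_mat n n" "mat_adjoint G = G" unfolding G_def using carr herm by (simp_all add: adj cl sa)
  define Z where "Z = 1\<^sub>m n - Pinv * (G * Rinv)"
  have Z: "Z \<in> carrier_mat n n" "mat_adjoint Z = 1\<^sub>m n - Rinv * (G * Pinv)"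
    unfolding Z_def using carr herm G by (simp_all add: adj cl sa)
  have "Z * R * mat_adjoint Z \<in> psd_mats n"
    using psd_congruence[OF R, of "mat_adjoint Z"] Z(1) by simp
  from mat_trace_psd_mult_nonneg[OF P this]
  have "0 \<le> Re (mat_trace (P * (Z * R * mat_adjoint Z)))" .
  also have "P * (Z * R * mat_adjoint Z) = (P * R - G) - (P * (G * Pinv) - G * (Rinv * (G * Pinv)))"
    unfolding Z(2) unfolding Z_def using carr G
    by (simp add: cl sa square_mat_distribs[where n=n] canc Rinv)
  also have "mat_trace \<dots> = mat_trace (P * R) - mat_trace G - (mat_trace (P * (G * Pinv)) - mat_trace (G * (Rinv * (G * Pinv))))"
    using carr G by (simp add: mat_trace_minus[where n=n] cl)
  also have "mat_trace (P * (G * Pinv)) = g"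
    using carr G mat_trace_comm[of P n n "G * Pinv"] by (simp add: cl sa Pinv) (simp add: G_def g_def)
  also have "mat_trace G = g" unfolding G_def g_def ..
  also have "G * (Rinv * (G * Pinv)) = P * (Y * (D * Y))"
    unfolding G_def D_def using carr by (simp add: cl sa Pinv)
  also have "mat_trace \<dots> = t" by (rule t')
  finally have s2: "0 \<le> Re (mat_trace (P * R) - g - (g - t))" .
  have "P * Y * P = P * (Y * P)" using carr by (simp add: sa)
  then show ?thesis using s1 s2 unfolding g_def by simp
qed

text \<open>The hypothesis on \<open>X\<close> is the Riccati equation of the geometric mean of \<open>P^2\<close> and the matrix with
  eigenvalues \<open>h\<close>. That \<open>h\<close> decreases is essential: for the projection onto an eigenvector of the
  smallest eigenvalue the inequality is reversed, by monotonicity of the mean.\<close>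

lemma mat_trace_top_proj_geo_mean_le:
  assumes P: "P \<in> pd_mats n" and Pinv: "Pinv \<in> pd_mats n" "P * Pinv = 1\<^sub>m n" "Pinv * P = 1\<^sub>m n"
    and U: "U \<in> unitary_mats n" and h: "\<And>i. i < n \<Longrightarrow> 0 < h i" "antimono_on {..<n} h"
    and X: "X \<in> carrier_mat n n" "mat_adjoint X = X" "X * (Pinv * Pinv) * X = unitary_diag n U h"
    and k: "1 \<le> k" "k \<le> n"
  shows "Re (mat_trace (top_proj n U k * X)) \<le> Re (mat_trace (top_proj n U k * (unitary_diag n U (\<lambda>i. sqrt (h i)) * P)))"
proof -
  define \<mu> where "\<mu> = h (k - 1)"
  \<comment> \<open>The smallest change of \<open>h\<close> that makes \<open>\<mu>\<close> a lower bound for the whole spectrum.\<close>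
  define h' where "h' = (\<lambda>i. if i < k then h i else \<mu>)"
  have \<mu>: "0 < \<mu>" unfolding \<mu>_def using h(1) k by auto
  have h': "h i \<le> h' i" "\<mu> \<le> h' i" "0 < h' i" if "i < n" for i
    using monotone_onD[OF h(2), of "k - 1" i] monotone_onD[OF h(2), of i "k - 1"] h(1)[OF that] k that \<mu> unfolding h'_def \<mu>_def by auto
  define R where "R = unitary_diag n U (\<lambda>i. sqrt (h' i))"
  define H' where "H' = unitary_diag n U h'"
  define E where "E = top_proj n U k"
  define F where "F = unitary_diag n U (\<lambda>i. if i < k then 0 else 1)"
  have R: "R \<in> pd_mats n" unfolding R_def using h'(3) by (simp add: unitary_diag_pd_iff[OF U])
  have H': "H' \<in> pd_mats n" unfolding H'_def using h'(3) by (simp add: unitary_diag_pd_iff[OF U])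
  have RR: "R * R = H'" unfolding R_def H'_def unitary_diag_mult[OF U]
    using h'(3) by (intro unitary_diag_cong) (simp add: less_imp_le)
  obtain Rinv where Rinv: "Rinv \<in> pd_mats n" "R * Rinv = 1\<^sub>m n" "Rinv * R = 1\<^sub>m n" using pd_inverse_exists[OF R] by blast
  note carr = pd_matsD(1)[OF P] pd_matsD(1)[OF Pinv(1)] pd_matsD(1)[OF R] pd_matsD(1)[OF H'] pd_matsD(1)[OF Rinv(1)]
  note herm = pd_matsD(2)[OF P] pd_matsD(2)[OF Pinv(1)] pd_matsD(2)[OF R] pd_matsD(2)[OF H'] pd_matsD(2)[OF Rinv(1)]
  note cl = square_mat_closed[where n=n]
  note sa = square_mat_assoc[where n=n]
  note adj = mat_adjoint_mult[where m=n and k=n and n=n]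
  note canc = cancel_left_inverse[where A=P and B=Pinv and n=n, OF Pinv(2) carr(1,2)]
    cancel_left_inverse[where A=Pinv and B=P and n=n, OF Pinv(3) carr(2,1)]
  have E: "E \<in> psd_mats n" "F \<in> psd_mats n" "E + F = 1\<^sub>m n"
    unfolding E_def F_def top_proj_def unitary_diag_psd_iff[OF U] unitary_diag_add[OF U]
    by (simp_all add: if_distrib[where f="\<lambda>x. x + _"] cong: if_cong)
       (subst unitary_diag_one[OF U, symmetric], rule unitary_diag_cong, simp)
  note ec = psd_matsD(1)[OF E(1)] psd_matsD(1)[OF E(2)]
  have "Pinv * H' * Pinv \<in> pd_mats n"
    using pd_congruence[OF H' carr(2) carr(1) Pinv(2)] herm by simp
  then obtain Y where Y: "Y \<in> pd_mats n" "Y * Y = Pinv * H' * Pinv" using pd_root_exists by blast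
  note y = pd_matsD(1,2)[OF Y(1)]
  \<comment> \<open>Monotonicity of the mean: \<open>P W P\<close> solves the Riccati equation for \<open>P^2\<close> and \<open>Q\<close>, and \<open>Q \<le> H'\<close>.\<close>
  have conj: "P * (Y - W) * P \<in> psd_mats n"
    if W: "W \<in> carrier_mat n n" "mat_adjoint W = W" "W * W = Pinv * Q * Pinv" and Q: "Q \<in> carrier_mat n n" "H' - Q \<in> psd_mats n" for W Q
  proof -
    have "Y * Y - W * W = Pinv * (H' - Q) * Pinv" unfolding Y W using carr Q
      by (simp add: cl sa square_mat_distribs[where n=n])
    then have "Y * Y - W * W \<in> psd_mats n" using psd_congruence_hermitian[OF Q(2) carr(2) herm(2)] by simp
    from psd_le_of_square_le[OF Y(1) W(1,2) this] show ?thesis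
      using psd_congruence_hermitian[OF _ carr(1) herm(1)] by blast
  qed
  define X' where "X' = P * Y * P"
  have X': "X' \<in> carrier_mat n n" unfolding X'_def using carr y by simp
  have "X' - X \<in> psd_mats n"
  proof -
    have "P * (Y - Pinv * X * Pinv) * P \<in> psd_mats n"
    proof (rule conj)
      show "Pinv * X * Pinv * (Pinv * X * Pinv) = Pinv * unitary_diag n U h * Pinv"
        unfolding X(3)[symmetric] using carr X(1) by (simp add: cl sa)
      have "H' - unitary_diag n U h = unitary_diag n U (\<lambda>i. h' i - h i)"
        unfolding H'_def by (rule unitary_diag_minus[OF U])
      then show "H' - unitary_diag n U h \<in> psd_mats n" using h'(1) by (simp add: unitary_diag_psd_iff[OF U])
    qed (use carr herm X U in \<open>auto simp: adj cl sa\<close>)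
    also have "P * (Y - Pinv * X * Pinv) * P = X' - X"
      unfolding X'_def using carr X y Pinv by (simp add: cl sa square_mat_distribs[where n=n] canc)
    finally show ?thesis .
  qed
  from mat_trace_psd_mult_nonneg[OF E(1) this] have 1: "Re (mat_trace (E * X)) \<le> Re (mat_trace (E * X'))"
    using ec X X' by (simp add: square_mat_distribs[where n=n] mat_trace_minus[where n=n] cl)
  \<comment> \<open>The geometric mean of \<open>P^2\<close> and \<open>\<mu> 1\<close> is \<open>\<mu>^(1/2) P\<close>.\<close>
  have "X' - complex_of_real (sqrt \<mu>) \<cdot>\<^sub>m P \<in> psd_mats n"
  proof -
    have "P * (Y - complex_of_real (sqrt \<mu>) \<cdot>\<^sub>m Pinv) * P \<in> psd_mats n"
    proof (rule conj)
      show "complex_of_real (sqrt \<mu>) \<cdot>\<^sub>m Pinv * (complex_of_real (sqrt \<mu>) \<cdot>\<^sub>m Pinv) = Pinv * unitary_diag n U (\<lambda>i. \<mu> * 1) * Pinv"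
        unfolding unitary_diag_smult[OF U, symmetric] unitary_diag_one[OF U] using carr \<mu>
        by (simp add: square_mat_distribs[where n=n] cl smult_smult_mat flip: of_real_mult)
      have "H' - unitary_diag n U (\<lambda>i. \<mu> * 1) = unitary_diag n U (\<lambda>i. h' i - \<mu>)"
        unfolding H'_def by (simp add: unitary_diag_minus[OF U])
      then show "H' - unitary_diag n U (\<lambda>i. \<mu> * 1) \<in> psd_mats n" using h'(2) by (simp add: unitary_diag_psd_iff[OF U])
    qed (use carr herm U in \<open>auto simp: mat_adjoint_smult cl sa\<close>)
    also have "P * (Y - complex_of_real (sqrt \<mu>) \<cdot>\<^sub>m Pinv) * P = X' - complex_of_real (sqrt \<mu>) \<cdot>\<^sub>m P"
      unfolding X'_def using carr y Pinv by (simp add: cl sa square_mat_distribs[where n=n] canc)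
    finally show ?thesis .
  qed
  from mat_trace_psd_mult_nonneg[OF E(2) this]
  have "Re (mat_trace (F * (complex_of_real (sqrt \<mu>) \<cdot>\<^sub>m P))) \<le> Re (mat_trace (F * X'))"
    using ec carr X' by (simp add: square_mat_distribs[where n=n] mat_trace_minus[where n=n] cl)
  also have "F * (complex_of_real (sqrt \<mu>) \<cdot>\<^sub>m P) = F * (R * P)"
  proof -
    have "F * R = complex_of_real (sqrt \<mu>) \<cdot>\<^sub>m F"
      unfolding F_def R_def unitary_diag_mult[OF U] unitary_diag_smult[OF U] by (rule unitary_diag_cong) (auto simp: h'_def)
    then have "F * R * P = complex_of_real (sqrt \<mu>) \<cdot>\<^sub>m F * P" by simp
    then show ?thesis using ec carr by (simp add: square_mat_distribs[where n=n] cl sa)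
  qed
  finally have 2: "Re (mat_trace (F * (R * P))) \<le> Re (mat_trace (F * X'))" .
  have "Re (mat_trace X') \<le> Re (mat_trace (P * R))" unfolding X'_def
    by (rule mat_trace_geo_mean_le[OF pd_mats_psd[OF P] pd_mats_psd[OF R] pd_mats_psd[OF Y(1)] pd_mats_psd[OF Pinv(1)] Pinv(2,3)
       pd_mats_psd[OF Rinv(1)] Rinv(2,3)]) (simp add: Y RR)
  also have "mat_trace (P * R) = mat_trace (R * P)" using carr by (intro mat_trace_comm)
  finally have 3: "Re (mat_trace X') \<le> Re (mat_trace (R * P))" .
  have split: "mat_trace (E * M) + mat_trace (F * M) = mat_trace M" if "M \<in> carrier_mat n n" for M
  proof -
    have "E * M + F * M = M" using that ec E(3) by (simp flip: add_mult_distrib_mat[of _ n n _ _ n])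
    then show ?thesis using that ec by (metis mat_trace_add mult_carrier_mat)
  qed
  have "Re (mat_trace (E * X)) \<le> Re (mat_trace (E * (R * P)))"
    using 1 2 3 split[OF X'] split[of "R * P"] carr by (simp add: complex_eq_iff cl)
  also have "E * (R * P) = E * (unitary_diag n U (\<lambda>i. sqrt (h i)) * P)"
  proof -
    have "E * R = E * unitary_diag n U (\<lambda>i. sqrt (h i))"
      unfolding E_def R_def top_proj_def unitary_diag_mult[OF U] by (rule unitary_diag_cong) (auto simp: h'_def)
    then have "E * R * P = E * unitary_diag n U (\<lambda>i. sqrt (h i)) * P" by simp
    then show ?thesis using ec carr U by (simp add: sa)
  qed
  finally show ?thesis unfolding E_def .
qed

section \<open>The sums of the largest eigenvalues\<close>

lemma square_of_sum:
  fixes a b :: real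
  assumes "P \<in> carrier_mat n n" "Q \<in> carrier_mat n n"
  defines "S \<equiv> complex_of_real a \<cdot>\<^sub>m P + complex_of_real b \<cdot>\<^sub>m Q"
  shows "S * S = complex_of_real (a^2) \<cdot>\<^sub>m (P * P) + complex_of_real (b^2) \<cdot>\<^sub>m (Q * Q)
              + complex_of_real (a * b) \<cdot>\<^sub>m (P * Q + Q * P)"
proof -
  have "S * S = (complex_of_real a * complex_of_real a) \<cdot>\<^sub>m (P * P) + (complex_of_real a * complex_of_real b) \<cdot>\<^sub>m (Q * P)
     + ((complex_of_real b * complex_of_real a) \<cdot>\<^sub>m (P * Q) + (complex_of_real b * complex_of_real b) \<cdot>\<^sub>m (Q * Q))"
    unfolding S_def using assms
    by (simp add: square_mat_assoc[where n=n] square_mat_closed[where n=n] square_mat_distribs[where n=n] smult_smult_mat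
         add_smult_distrib_left_mat[of _ n n] mult.commute)
  also have "\<dots> = complex_of_real (a^2) \<cdot>\<^sub>m (P * P) + complex_of_real (b^2) \<cdot>\<^sub>m (Q * Q)
              + complex_of_real (a * b) \<cdot>\<^sub>m (P * Q + Q * P)"
    using assms(1,2) by (intro eq_matI) (auto simp: power2_eq_square algebra_simps simp del: index_mult_mat(1))
  finally show ?thesis .
qed

text \<open>Both \<open>X\<close> and \<open>Y\<close> in the proof are geometric means with \<open>H\<close> itself, of \<open>A\<close> and of \<open>B\<close>, and
  \<open>H = a X + b Y\<close>. Since \<open>E\<close> commutes with the square root \<open>R\<close> of \<open>H\<close>, the mixed terms of
  \<open>tr E (R - S)^2\<close> coincide and bound \<open>tr E R S\<close> by the mean of \<open>tr E H\<close> and \<open>tr E S^2\<close>.\<close>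

lemma mat_trace_top_proj_power_mean_le:
  fixes a b :: real
  assumes A: "A \<in> pd_mats n" and B: "B \<in> pd_mats n" and ab: "0 < a" "0 < b"
  defines "H \<equiv> complex_of_real (a^2) \<cdot>\<^sub>m A + complex_of_real (b^2) \<cdot>\<^sub>m B
              + complex_of_real (2 * a * b) \<cdot>\<^sub>m geo_mean A B"
    and "S \<equiv> complex_of_real a \<cdot>\<^sub>m mat_sqrt A + complex_of_real b \<cdot>\<^sub>m mat_sqrt B"
  assumes U: "U \<in> unitary_mats n" and h: "H = unitary_diag n U h" "antimono_on {..<n} h"
    and k: "1 \<le> k" "k \<le> n"
  shows "Re (mat_trace (top_proj n U k * H)) \<le> Re (mat_trace (top_proj n U k * (S * S)))"
proof -
  define P where "P = mat_sqrt A"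
  define Pinv where "Pinv = mat_inv P"
  define Q where "Q = mat_sqrt B"
  define Qinv where "Qinv = mat_inv Q"
  define G where "G = geo_mean A B"
  have P: "P \<in> pd_mats n" "P * P = A" unfolding P_def using mat_sqrt_pd[OF A] by auto
  have Q: "Q \<in> pd_mats n" "Q * Q = B" unfolding Q_def using mat_sqrt_pd[OF B] by auto
  note Pinv = mat_inv_pd[OF P(1), folded Pinv_def] and Qinv = mat_inv_pd[OF Q(1), folded Qinv_def]
  have G: "G \<in> pd_mats n" "G * (Pinv * Pinv) * G = B" "G * (Qinv * Qinv) * G = A"
    unfolding G_def Pinv_def Qinv_def P_def Q_def using geo_mean_riccati[OF A B] by auto
  note carr = pd_matsD(1)[OF P(1)] pd_matsD(1)[OF Pinv(1)] pd_matsD(1)[OF Q(1)] pd_matsD(1)[OF Qinv(1)]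
    pd_matsD(1)[OF A] pd_matsD(1)[OF B] pd_matsD(1)[OF G(1)]
  note herm = pd_matsD(2)[OF P(1)] pd_matsD(2)[OF Q(1)] pd_matsD(2)[OF A] pd_matsD(2)[OF B] pd_matsD(2)[OF G(1)]
  note cl = square_mat_closed[where n=n] and sa = square_mat_assoc[where n=n] and sd = square_mat_distribs[where n=n]
  define X where "X = complex_of_real a \<cdot>\<^sub>m A + complex_of_real b \<cdot>\<^sub>m G"
  define Y where "Y = complex_of_real b \<cdot>\<^sub>m B + complex_of_real a \<cdot>\<^sub>m G"
  have "X * (Pinv * Pinv) * X = H"
    using riccati_shift[OF carr(1,2) Pinv(2,3) carr(7) G(2) carr(6), of a b] unfolding P(2) X_def H_def G_def by simp
  then have X: "X \<in> carrier_mat n n" "mat_adjoint X = X" "X * (Pinv * Pinv) * X = unitary_diag n U h"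
    using carr herm h(1) unfolding X_def by (simp_all add: cl mat_adjoint_add[where m=n and n=n] mat_adjoint_smult)
  have "Y * (Qinv * Qinv) * Y = complex_of_real (b^2) \<cdot>\<^sub>m B + complex_of_real (a^2) \<cdot>\<^sub>m A + complex_of_real (2 * b * a) \<cdot>\<^sub>m G"
    using riccati_shift[OF carr(3,4) Qinv(2,3) carr(7) G(3) carr(5), of b a] unfolding Q(2) Y_def by simp
  also have "\<dots> = H" unfolding H_def G_def[symmetric] using carr by (intro eq_matI) auto
  finally have Y: "Y \<in> carrier_mat n n" "mat_adjoint Y = Y" "Y * (Qinv * Qinv) * Y = unitary_diag n U h"
    using carr herm h(1) unfolding Y_def by (simp_all add: cl mat_adjoint_add[where m=n and n=n] mat_adjoint_smult)
  have HXY: "H = complex_of_real a \<cdot>\<^sub>m X + complex_of_real b \<cdot>\<^sub>m Y"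
    unfolding H_def X_def Y_def G_def[symmetric] using carr by (intro eq_matI) (auto simp: power2_eq_square algebra_simps)
  have "H \<in> pd_mats n" unfolding H_def G_def[symmetric]
    using A B G ab by (intro pd_add_psd pd_mats_psd pd_smult) auto
  then have hpos: "0 < h i" if "i < n" for i using that unfolding h unitary_diag_pd_iff[OF U] by blast
  define E where "E = top_proj n U k"
  define R where "R = unitary_diag n U (\<lambda>i. sqrt (h i))"
  have E: "E \<in> psd_mats n" unfolding E_def using top_proj_complement[OF U] by auto
  note ec = psd_matsD(1)[OF E]
  have R: "R \<in> carrier_mat n n" "mat_adjoint R = R" unfolding R_def using U hermitian_unitary_diag[OF U] by (auto simp: hermitian_mat_def)
  have RR: "R * R = H" unfolding R_def h unitary_diag_mult[OF U] using hpos by (intro unitary_diag_cong) (simp add: less_imp_le)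
  have ER: "R * E = E * R" unfolding R_def E_def top_proj_def unitary_diag_mult[OF U] by (rule unitary_diag_cong) simp
  have S: "S \<in> carrier_mat n n" "mat_adjoint S = S"
    unfolding S_def P_def[symmetric] Q_def[symmetric] using carr herm
    by (simp_all add: cl mat_adjoint_add[where m=n and n=n] mat_adjoint_smult)
  have Sx: "S = complex_of_real a \<cdot>\<^sub>m P + complex_of_real b \<cdot>\<^sub>m Q" unfolding S_def P_def Q_def ..
  have 1: "Re (mat_trace (E * X)) \<le> Re (mat_trace (E * (R * P)))" unfolding E_def R_def
    by (rule mat_trace_top_proj_geo_mean_le[OF P(1) Pinv U hpos h(2) X k])
  have 2: "Re (mat_trace (E * Y)) \<le> Re (mat_trace (E * (R * Q)))" unfolding E_def R_def
    by (rule mat_trace_top_proj_geo_mean_le[OF Q(1) Qinv U hpos h(2) Y k])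
  have "Re (mat_trace (E * H)) = a * Re (mat_trace (E * X)) + b * Re (mat_trace (E * Y))"
    unfolding HXY using ec X(1) Y(1) by (simp add: cl sd mat_trace_add[where n=n] mat_trace_smult[where n=n])
  also have "\<dots> \<le> a * Re (mat_trace (E * (R * P))) + b * Re (mat_trace (E * (R * Q)))"
    using 1 2 ab by (intro add_mono mult_left_mono) auto
  also have "\<dots> = Re (mat_trace (E * (R * S)))"
    unfolding Sx using ec R(1) carr by (simp add: cl sd mat_trace_add[where n=n] mat_trace_smult[where n=n])
  finally have 3: "Re (mat_trace (E * H)) \<le> Re (mat_trace (E * (R * S)))" .
  have "(R - S) * (R - S) \<in> psd_mats n"
    using R S by (intro hermitian_square_psd) (auto simp: mat_adjoint_minus[where m=n and n=n])
  from mat_trace_psd_mult_nonneg[OF E this]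
  have "0 \<le> Re (mat_trace (E * (R * R))) - Re (mat_trace (E * (S * R))) - (Re (mat_trace (E * (R * S))) - Re (mat_trace (E * (S * S))))"
    using ec R(1) S(1) by (simp add: cl sd mat_trace_minus[where n=n])
  also have "mat_trace (E * (S * R)) = mat_trace (E * (R * S))"
  proof -
    have "mat_trace (E * (S * R)) = mat_trace ((E * S) * R)" using ec R(1) S(1) by (simp add: sa)
    also have "\<dots> = mat_trace (R * (E * S))" using ec R(1) S(1) by (intro mat_trace_comm[of _ n n]) (auto simp: cl)
    also have "R * (E * S) = (R * E) * S" using ec R(1) S(1) by (simp add: sa)
    finally show ?thesis unfolding ER using ec R(1) S(1) by (simp add: sa)
  qed
  finally show ?thesis using 3 unfolding RR E_def by simp
qed

lemma partial_sums_le: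
  fixes a b :: real
  assumes A: "A \<in> pd_mats n" and B: "B \<in> pd_mats n" and ab: "0 < a" "0 < b"
  assumes U: "U \<in> unitary_mats n" and h: "complex_of_real (a^2) \<cdot>\<^sub>m A + complex_of_real (b^2) \<cdot>\<^sub>m B
              + complex_of_real (2 * a * b) \<cdot>\<^sub>m geo_mean A B = unitary_diag n U h" "antimono_on {..<n} h"
    and V: "V \<in> unitary_mats n" and t: "complex_of_real (a^2) \<cdot>\<^sub>m A + complex_of_real (b^2) \<cdot>\<^sub>m B
              + complex_of_real (a * b) \<cdot>\<^sub>m (mat_sqrt A * mat_sqrt B + mat_sqrt B * mat_sqrt A) = unitary_diag n V t" "antimono_on {..<n} t"
    and k: "k \<le> n"
  shows "(\<Sum>i<k. h i) \<le> (\<Sum>i<k. t i)"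
proof (cases "k = 0")
  case False
  then have k1: "1 \<le> k" by simp
  have "(\<Sum>i<k. h i) = Re (mat_trace (top_proj n U k * unitary_diag n U h))" by (rule mat_trace_top_proj_unitary_diag[OF U k, symmetric])
  also have "\<dots> \<le> Re (mat_trace (top_proj n U k * unitary_diag n V t))"
    using mat_trace_top_proj_power_mean_le[OF A B ab U h k1 k]
      square_of_sum[OF pd_matsD(1)[OF mat_sqrt_pd(1)[OF A]] pd_matsD(1)[OF mat_sqrt_pd(1)[OF B]], of a b]
    unfolding mat_sqrt_pd(2)[OF A] mat_sqrt_pd(2)[OF B] t h by simp
  also have "\<dots> \<le> (\<Sum>i<k. t i)" by (rule ky_fan[OF V U k1 k t(2)])
  finally show ?thesis .
qed simp

section \<open>Ky Fan dominance for unitarily invariant norms\<close>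

text \<open>A convex function on \<open>n\<close>-vectors that is invariant under permutations and sign changes is monotone
  under weak majorization. Each step moves one more coordinate of \<open>y\<close> to its value in \<open>x\<close> without
  destroying the hypothesis on partial sums. If \<open>x \<le> y\<close>
  pointwise, one coordinate of \<open>y\<close> is lowered, by averaging \<open>y\<close> with its reflection. Otherwise mass \<open>\<delta>\<close>
  is moved from a coordinate \<open>j\<close> to a later coordinate \<open>k\<close>; the result is an average of \<open>y\<close> and of \<open>y\<close>
  with these coordinates exchanged.\<close>

lemma weak_majorization_gauge_le:
  fixes g :: "(nat \<Rightarrow> real) \<Rightarrow> real"
  assumes conv: "\<And>x y z u. 0 \<le> u \<Longrightarrow> u \<le> 1 \<Longrightarrow> (\<And>i. i < n \<Longrightarrow> z i = u * x i + (1 - u) * y i) \<Longrightarrow> g z \<le> u * g x + (1 - u) * g y"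
    and swap: "\<And>x j k. j < n \<Longrightarrow> k < n \<Longrightarrow> g (x \<circ> Transposition.transpose j k) = g x"
    and flip: "\<And>x j. j < n \<Longrightarrow> g (x(j := - x j)) = g x"
    and x: "antimono_on {..<n} x" "\<And>i. i < n \<Longrightarrow> 0 \<le> x i"
    and le: "\<And>k. k \<le> n \<Longrightarrow> (\<Sum>i<k. x i) \<le> (\<Sum>i<k. y i)"
  shows "g x \<le> g y"
  using le
proof (induction "card {i. i < n \<and> x i \<noteq> y i}" arbitrary: y rule: less_induct)
  case less
  have conv_same: "g z \<le> g w" if u: "0 \<le> u" "u \<le> 1" "\<And>i. i < n \<Longrightarrow> z i = u * w i + (1 - u) * v i" "g v = g w" for z w v u
  proof -
    have "g z \<le> u * g w + (1 - u) * g v" using conv[OF u(1-3)] .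
    also have "\<dots> = g w" unfolding u(4) by (simp add: algebra_simps)
    finally show ?thesis .
  qed
  have smaller: "card {i. i < n \<and> x i \<noteq> z i} < card {i. i < n \<and> x i \<noteq> y i}"
    if "\<And>i. i < n \<Longrightarrow> x i = y i \<Longrightarrow> x i = z i" "j < n" "x j = z j" "x j \<noteq> y j" for z j
    using that by (intro psubset_card_mono) auto
  show ?case
  proof (cases "\<exists>i<n. x i \<noteq> y i")
    case False
    then show ?thesis using conv_same[of 1 x y y] by simp
  next
    case ne: True
    show ?thesis
    proof (cases "\<exists>k<n. y k < x k")
      case False
      obtain j where j: "j < n" "x j \<noteq> y j" using ne by blast
      with False have jl: "x j < y j" by force
      define z where "z = y(j := x j)"
      have "g z \<le> g y"
      proof (rule conv_same[where u="(1 + x j / y j) / 2"])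
        have "0 < y j" using x(2)[OF j(1)] jl by simp
        then show "0 \<le> (1 + x j / y j) / 2" "(1 + x j / y j) / 2 \<le> 1" using x(2)[OF j(1)] jl by (auto simp: field_simps)
        show "z i = (1 + x j / y j) / 2 * y i + (1 - (1 + x j / y j) / 2) * (y(j := - y j)) i" for i
          using \<open>0 < y j\<close> unfolding z_def by (auto simp: field_simps)
        show "g (y(j := - y j)) = g y" by (rule flip[OF j(1)])
      qed
      moreover have "g x \<le> g z"
      proof (rule less.hyps)
        show "card {i. i < n \<and> x i \<noteq> z i} < card {i. i < n \<and> x i \<noteq> y i}"
          using j by (intro smaller[of z j]) (auto simp: z_def)
        show "(\<Sum>i<k. x i) \<le> (\<Sum>i<k. z i)" if "k \<le> n" for k
        proof (intro sum_mono)
          fix i assume "i \<in> {..<k}"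
          then have "i < n" using that by simp
          then have "x i \<le> y i" using False by force
          then show "x i \<le> z i" by (simp add: z_def)
        qed
      qed
      ultimately show ?thesis by simp
    next
      case True
      \<comment> \<open>\<open>k\<close> is the first excess of \<open>x\<close> over \<open>y\<close>, and \<open>j\<close> the last deficit before it, so that \<open>x\<close> and
        \<open>y\<close> agree in between and the partial sums up to there have a slack of at least \<open>y j - x j\<close>.\<close>
      define k where "k = (LEAST k. k < n \<and> y k < x k)"
      have k: "k < n" "y k < x k" and kmin: "\<And>i. i < k \<Longrightarrow> x i \<le> y i"
      proof -
        show "k < n" "y k < x k" using LeastI_ex[of "\<lambda>k. k < n \<and> y k < x k"] True unfolding k_def by auto
        then show "x i \<le> y i" if "i < k" for i
          using not_less_Least[of i "\<lambda>k. k < n \<and> y k < x k"] that unfolding k_def[symmetric] by force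
      qed
      have ex: "\<exists>j<k. x j < y j"
      proof (rule ccontr)
        assume "\<not> ?thesis"
        then have "(\<Sum>i<k. y i) \<le> (\<Sum>i<k. x i)" by (intro sum_mono) force
        then have "(\<Sum>i<Suc k. y i) < (\<Sum>i<Suc k. x i)" using k by simp
        then show False using less.prems[of "Suc k"] k by simp
      qed
      define j where "j = Max {j. j < k \<and> x j < y j}"
      have fin: "finite {j. j < k \<and> x j < y j}" by simp
      have j: "j < k" "x j < y j" using Max_in[OF fin] ex unfolding j_def by auto
      have between: "x i = y i" if "j < i" "i < k" for i
      proof (rule ccontr)
        assume "x i \<noteq> y i"
        then have "i \<le> j" unfolding j_def using kmin[OF that(2)] that by (intro Max_ge[OF fin]) auto
        then show False using that by simp
      qed
      \<comment> \<open>The largest amount that overshoots neither \<open>x j\<close> nor \<open>x k\<close>; it attains one of them.\<close>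
      define \<delta> where "\<delta> = min (y j - x j) (x k - y k)"
      have \<delta>: "0 < \<delta>" "\<delta> \<le> y j - x j" "\<delta> \<le> x k - y k" unfolding \<delta>_def using j k by auto
      have xkj: "x k \<le> x j" using x(1) j k unfolding monotone_on_def by auto
      define z where "z = y(j := y j - \<delta>, k := y k + \<delta>)"
      have "g z \<le> g y"
      proof (rule conv_same[where u="1 - \<delta> / (y j - y k)"])
        have d: "0 < y j - y k" "\<delta> \<le> y j - y k" using \<delta> xkj k j by auto
        then show "0 \<le> 1 - \<delta> / (y j - y k)" "1 - \<delta> / (y j - y k) \<le> 1" using \<delta> by (auto simp: field_simps)
        show "z i = (1 - \<delta> / (y j - y k)) * y i + (1 - (1 - \<delta> / (y j - y k))) * (y \<circ> Transposition.transpose j k) i" for i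
        proof -
          have jk: "j \<noteq> k" using j by simp
          have e: "\<delta> / (y j - y k) * y j = \<delta> / (y j - y k) * y k + \<delta>" using d by (simp add: field_simps)
          consider "i = j" | "i = k" | "i \<noteq> j" "i \<noteq> k" by blast
          then show ?thesis
          proof cases
            case 1 then show ?thesis using e jk unfolding z_def by (simp add: left_diff_distrib)
          next
            case 2 then show ?thesis using e jk unfolding z_def by (simp add: left_diff_distrib)
          next
            case 3 then show ?thesis unfolding z_def by (simp add: left_diff_distrib)
          qed
        qed
        show "g (y \<circ> Transposition.transpose j k) = g y" using swap j k by simp
      qed
      moreover have "g x \<le> g z"
      proof (rule less.hyps)
        have jk: "j \<noteq> k" using j by simp
        have "x j = z j \<or> x k = z k" using jk unfolding z_def \<delta>_def by (auto simp: min_def)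
        then obtain l where l: "l = j \<or> l = k" "x l = z l" by blast
        show "card {i. i < n \<and> x i \<noteq> z i} < card {i. i < n \<and> x i \<noteq> y i}"
          using l j k by (intro smaller[of z l]) (auto simp: z_def)
        show "(\<Sum>i<m. x i) \<le> (\<Sum>i<m. z i)" if m: "m \<le> n" for m
        proof -
          have zi: "z i = y i - (if i = j then \<delta> else 0) + (if i = k then \<delta> else 0)" for i
            using jk unfolding z_def by auto
          have sz: "(\<Sum>i<m. z i) = (\<Sum>i<m. y i) - (if j < m then \<delta> else 0) + (if k < m then \<delta> else 0)"
            unfolding zi by (simp add: sum.distrib sum_subtractf)
          show ?thesis
          proof (cases "j < m \<and> m \<le> k")
            case False
            then show ?thesis using less.prems[OF m] j(1) unfolding sz by auto
          next
            case True
            have "(\<Sum>i<m. y i - x i) = (\<Sum>i\<in>{..<j} \<union> {j} \<union> {j<..<m}. y i - x i)"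
              using True by (intro sum.cong) auto
            also have "\<dots> = (\<Sum>i<j. y i - x i) + (y j - x j) + (\<Sum>i\<in>{j<..<m}. y i - x i)"
              by (subst sum.union_disjoint, auto)+
            also have "(\<Sum>i\<in>{j<..<m}. y i - x i) = 0" using True between by (intro sum.neutral) auto
            finally have "(\<Sum>i<m. y i - x i) = (\<Sum>i<j. y i - x i) + (y j - x j)" by simp
            moreover have "0 \<le> (\<Sum>i<j. y i - x i)" using less.prems[of j] j k by (simp add: sum_subtractf)
            ultimately show ?thesis using \<delta>(2) True unfolding sz by (simp add: sum_subtractf)
          qed
        qed
      qed
      ultimately show ?thesis by simp
    qed
  qed
qed

lemma real_diag_unitary_diag: "real_diag n d = unitary_diag n (1\<^sub>m n) d" and one_unitary: "1\<^sub>m n \<in> unitary_mats n"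
proof -
  show "1\<^sub>m n \<in> unitary_mats n" by (rule unitary_matsI) auto
  show "real_diag n d = unitary_diag n (1\<^sub>m n) d" unfolding unitary_diag_def by simp
qed

lemma unitarily_invariant_norm_unitary_diag:
  assumes N: "unitarily_invariant_norm n N" and U: "U \<in> unitary_mats n"
  shows "N (unitary_diag n U d) = N (real_diag n d)"
  using N unitary_mats_adjoint[OF U] U real_diag_carrier(1)[of n d]
  unfolding unitarily_invariant_norm_def unitary_diag_def by blast

text \<open>By unitary invariance the norm of each matrix is that of its diagonal of eigenvalues, and on real
  diagonal matrices the norm is convex and invariant under permutations and sign changes.\<close>

lemma ky_fan_dominance:
  assumes N: "unitarily_invariant_norm n N" and U: "U \<in> unitary_mats n" and V: "V \<in> unitary_mats n"
    and x: "antimono_on {..<n} x" "\<And>i. i < n \<Longrightarrow> 0 \<le> x i"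
    and le: "\<And>k. k \<le> n \<Longrightarrow> (\<Sum>i<k. x i) \<le> (\<Sum>i<k. y i)"
  shows "N (unitary_diag n U x) \<le> N (unitary_diag n V y)"
proof -
  have tri: "N (X + Y) \<le> N X + N Y" if "X \<in> carrier_mat n n" "Y \<in> carrier_mat n n" for X Y
    using N that unfolding unitarily_invariant_norm_def mat_norm_def by blast
  have hom: "N (c \<cdot>\<^sub>m X) = cmod c * N X" if "X \<in> carrier_mat n n" for X c
    using N that unfolding unitarily_invariant_norm_def mat_norm_def by blast
  have inv: "N (W * X * Z) = N X" if "X \<in> carrier_mat n n" "W \<in> unitary_mats n" "Z \<in> unitary_mats n" for W X Z
    using N that unfolding unitarily_invariant_norm_def by blast
  have "N (real_diag n x) \<le> N (real_diag n y)"
  proof (rule weak_majorization_gauge_le[where g="\<lambda>d. N (real_diag n d)", OF _ _ _ x le])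
    fix x y z :: "nat \<Rightarrow> real" and u :: real
    assume u: "0 \<le> u" "u \<le> 1" and z: "\<And>i. i < n \<Longrightarrow> z i = u * x i + (1 - u) * y i"
    have "real_diag n z = complex_of_real u \<cdot>\<^sub>m real_diag n x + complex_of_real (1 - u) \<cdot>\<^sub>m real_diag n y"
      using z by (intro eq_matI) auto
    also have "N \<dots> \<le> N (complex_of_real u \<cdot>\<^sub>m real_diag n x) + N (complex_of_real (1 - u) \<cdot>\<^sub>m real_diag n y)"
      by (rule tri) auto
    also have "\<dots> = u * N (real_diag n x) + (1 - u) * N (real_diag n y)"
      unfolding hom[OF real_diag_carrier(1)] norm_of_real using u by simp
    finally show "N (real_diag n z) \<le> u * N (real_diag n x) + (1 - u) * N (real_diag n y)" .
  next
    fix x :: "nat \<Rightarrow> real" and j k assume jk: "j < n" "k < n"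
    have "Transposition.transpose j k permutes {..<n}" using jk by (intro permutes_swap_id) auto
    from unitary_diag_permute[OF one_unitary this, of x] obtain W where W: "W \<in> unitary_mats n"
      "real_diag n x = unitary_diag n W (x \<circ> Transposition.transpose j k)" unfolding real_diag_unitary_diag[symmetric] comp_def by blast
    show "N (real_diag n (x \<circ> Transposition.transpose j k)) = N (real_diag n x)"
      unfolding W(2) unitarily_invariant_norm_unitary_diag[OF N W(1)] ..
  next
    fix x :: "nat \<Rightarrow> real" and j assume j: "j < n"
    define s where "s = (\<lambda>i. if i = j then - 1 else 1 :: real)"
    have "real_diag n s \<in> unitary_mats n"
      by (rule unitary_matsI) (auto simp: mat_adjoint_real_diag real_diag_mult real_diag_one[symmetric] s_def intro!: arg_cong[where f="real_diag n"])
    moreover have "real_diag n (x(j := - x j)) = real_diag n s * real_diag n x * 1\<^sub>m n"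
      by (auto simp: real_diag_mult s_def intro!: arg_cong[where f="real_diag n"])
    ultimately show "N (real_diag n (x(j := - x j))) = N (real_diag n x)"
      using inv[OF real_diag_carrier(1) _ one_unitary] by simp
  qed
  then show ?thesis unfolding unitarily_invariant_norm_unitary_diag[OF N U] unitarily_invariant_norm_unitary_diag[OF N V] .
qed

section \<open>The comparison of the two means\<close>

text \<open>For \<open>a b = 0\<close> both matrices are equal. The case is treated separately because the main argument
  inverts \<open>H\<close>, which is zero for \<open>a = b = 0\<close>.\<close>

lemma power_mean_comparison:
  fixes a b :: real
  assumes A: "A \<in> pd_mats n" and B: "B \<in> pd_mats n" and ab: "0 \<le> a" "0 \<le> b"
  defines "H \<equiv> complex_of_real (a^2) \<cdot>\<^sub>m A + complex_of_real (b^2) \<cdot>\<^sub>m B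
              + complex_of_real (2 * a * b) \<cdot>\<^sub>m geo_mean A B"
    and "K \<equiv> complex_of_real (a^2) \<cdot>\<^sub>m A + complex_of_real (b^2) \<cdot>\<^sub>m B
              + complex_of_real (a * b) \<cdot>\<^sub>m (mat_sqrt A * mat_sqrt B + mat_sqrt B * mat_sqrt A)"
  shows "eigvals_desc H \<prec>\<^sub>w eigvals_desc K" "unitarily_invariant_norm n N \<Longrightarrow> N H \<le> N K"
proof -
  note c = pd_matsD(1)[OF A] pd_matsD(1)[OF B] pd_matsD(1)[OF geo_mean_riccati(1)[OF A B]]
    pd_matsD(1)[OF mat_sqrt_pd(1)[OF A]] pd_matsD(1)[OF mat_sqrt_pd(1)[OF B]]
  note cl = square_mat_closed[where n=n]
  have "eigvals_desc H \<prec>\<^sub>w eigvals_desc K \<and> (\<forall>N. unitarily_invariant_norm n N \<longrightarrow> N H \<le> N K)"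
  proof (cases "a * b = 0")
    case True
    have "0 \<cdot>\<^sub>m M = 0\<^sub>m n n" if "M \<in> carrier_mat n n" for M :: "complex mat" using that by (intro eq_matI) auto
    then have "H = K" unfolding H_def K_def using True c by (auto simp: cl)
    then show ?thesis by (simp add: weakly_majorized_def)
  next
    case False
    then have ab: "0 < a" "0 < b" using ab by auto
    have "H \<in> pd_mats n" unfolding H_def
      using A B geo_mean_riccati(1)[OF A B] ab by (intro pd_add_psd pd_mats_psd pd_smult) auto
    note H = this pd_matsD(1,2)[OF this]
    obtain U h where U: "U \<in> unitary_mats n" "H = unitary_diag n U h" and hd: "antimono_on {..<n} h"
      using hermitian_spectral_desc[OF H(2,3)] by blast
    define S where "S = complex_of_real a \<cdot>\<^sub>m mat_sqrt A + complex_of_real b \<cdot>\<^sub>m mat_sqrt B"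
    have S: "S \<in> carrier_mat n n" "mat_adjoint S = S"
      unfolding S_def using c pd_matsD(2)[OF mat_sqrt_pd(1)[OF A]] pd_matsD(2)[OF mat_sqrt_pd(1)[OF B]]
      by (simp_all add: cl mat_adjoint_add[where m=n and n=n] mat_adjoint_smult)
    have "S * S = K" unfolding S_def square_of_sum[OF c(4,5)] mat_sqrt_pd[OF A] mat_sqrt_pd[OF B] K_def ..
    then have K: "K \<in> psd_mats n" using hermitian_square_psd[OF S] by simp
    obtain V t where V: "V \<in> unitary_mats n" "K = unitary_diag n V t" and td: "antimono_on {..<n} t"
      using hermitian_spectral_desc[OF psd_matsD(1,2)[OF K]] by blast
    have le: "(\<Sum>i<k. h i) \<le> (\<Sum>i<k. t i)" if "k \<le> n" for k
      by (rule partial_sums_le[OF A B ab U(1) U(2)[unfolded H_def] hd V(1) V(2)[unfolded K_def] td that])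
    have pos: "0 \<le> h i" if "i < n" for i
      using H(1) that unfolding U(2) unitary_diag_pd_iff[OF U(1)] by (simp add: less_imp_le)
    have "eigvals_desc H \<prec>\<^sub>w eigvals_desc K"
      unfolding U(2) V(2) eigvals_desc_unitary_diag[OF U(1) hd] eigvals_desc_unitary_diag[OF V(1) td]
      by (rule weakly_majorized_desc[OF hd td le])
    moreover have "N H \<le> N K" if "unitarily_invariant_norm n N" for N
      unfolding U(2) V(2) by (rule ky_fan_dominance[OF that U(1) V(1) hd pos le])
    ultimately show ?thesis by blast
  qed
  then show "eigvals_desc H \<prec>\<^sub>w eigvals_desc K" "unitarily_invariant_norm n N \<Longrightarrow> N H \<le> N K" by blast+
qed

theorem theorem5p3:
  fixes n :: nat and A B :: "complex mat" and a b :: real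
  assumes "A \<in> pd_mats n" and "B \<in> pd_mats n" and "0 \<le> a" and "0 \<le> b"
  shows "eigvals_desc (complex_of_real (a^2) \<cdot>\<^sub>m A + complex_of_real (b^2) \<cdot>\<^sub>m B
              + complex_of_real (2 * a * b) \<cdot>\<^sub>m geo_mean A B)
           \<prec>\<^sub>w eigvals_desc (complex_of_real (a^2) \<cdot>\<^sub>m A + complex_of_real (b^2) \<cdot>\<^sub>m B
              + complex_of_real (a * b) \<cdot>\<^sub>m (mat_sqrt A * mat_sqrt B + mat_sqrt B * mat_sqrt A))
         \<and> (\<forall>N. unitarily_invariant_norm n N \<longrightarrow>
              N (complex_of_real (a^2) \<cdot>\<^sub>m A + complex_of_real (b^2) \<cdot>\<^sub>m B
                  + complex_of_real (2 * a * b) \<cdot>\<^sub>m geo_mean A B)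
                \<le> N ((complex_of_real a \<cdot>\<^sub>m mat_sqrt A + complex_of_real b \<cdot>\<^sub>m mat_sqrt B) ^\<^sub>m 2))
         \<and> (\<forall>N. unitarily_invariant_norm n N \<longrightarrow>
              N (A + B + 2 \<cdot>\<^sub>m geo_mean A B)
                \<le> N (A + B + mat_sqrt A * mat_sqrt B + mat_sqrt B * mat_sqrt A))"
proof (intro conjI allI impI)
  note A = assms(1) and B = assms(2)
  note c = pd_matsD(1)[OF A] pd_matsD(1)[OF B] pd_matsD(1)[OF geo_mean_riccati(1)[OF A B]]
    pd_matsD(1)[OF mat_sqrt_pd(1)[OF A]] pd_matsD(1)[OF mat_sqrt_pd(1)[OF B]]
  note cl = square_mat_closed[where n=n]
  show "eigvals_desc (complex_of_real (a^2) \<cdot>\<^sub>m A + complex_of_real (b^2) \<cdot>\<^sub>m B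
              + complex_of_real (2 * a * b) \<cdot>\<^sub>m geo_mean A B)
           \<prec>\<^sub>w eigvals_desc (complex_of_real (a^2) \<cdot>\<^sub>m A + complex_of_real (b^2) \<cdot>\<^sub>m B
              + complex_of_real (a * b) \<cdot>\<^sub>m (mat_sqrt A * mat_sqrt B + mat_sqrt B * mat_sqrt A))"
    by (rule power_mean_comparison(1)[OF assms])
  fix N assume N: "unitarily_invariant_norm n N"
  define S where "S = complex_of_real a \<cdot>\<^sub>m mat_sqrt A + complex_of_real b \<cdot>\<^sub>m mat_sqrt B"
  have "S \<in> carrier_mat n n" unfolding S_def using c by (simp add: cl)
  then have "S ^\<^sub>m 2 = S * S" by (simp add: numeral_2_eq_2)
  also have "\<dots> = complex_of_real (a^2) \<cdot>\<^sub>m A + complex_of_real (b^2) \<cdot>\<^sub>m B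
              + complex_of_real (a * b) \<cdot>\<^sub>m (mat_sqrt A * mat_sqrt B + mat_sqrt B * mat_sqrt A)"
    unfolding S_def square_of_sum[OF c(4,5)] mat_sqrt_pd[OF A] mat_sqrt_pd[OF B] ..
  finally show "N (complex_of_real (a^2) \<cdot>\<^sub>m A + complex_of_real (b^2) \<cdot>\<^sub>m B
                  + complex_of_real (2 * a * b) \<cdot>\<^sub>m geo_mean A B)
                \<le> N ((complex_of_real a \<cdot>\<^sub>m mat_sqrt A + complex_of_real b \<cdot>\<^sub>m mat_sqrt B) ^\<^sub>m 2)"
    using power_mean_comparison(2)[OF assms N] unfolding S_def by simp
next
  note A = assms(1) and B = assms(2)
  note c = pd_matsD(1)[OF A] pd_matsD(1)[OF B] pd_matsD(1)[OF geo_mean_riccati(1)[OF A B]]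
    pd_matsD(1)[OF mat_sqrt_pd(1)[OF A]] pd_matsD(1)[OF mat_sqrt_pd(1)[OF B]]
  fix N assume N: "unitarily_invariant_norm n N"
  have one: "1 \<cdot>\<^sub>m M = M" for M :: "complex mat" by (rule eq_matI) auto
  have "A + B + mat_sqrt A * mat_sqrt B + mat_sqrt B * mat_sqrt A
    = A + B + (mat_sqrt A * mat_sqrt B + mat_sqrt B * mat_sqrt A)"
    using c by (simp add: assoc_add_mat[of _ n n] square_mat_closed[where n=n])
  then show "N (A + B + 2 \<cdot>\<^sub>m geo_mean A B)
                \<le> N (A + B + mat_sqrt A * mat_sqrt B + mat_sqrt B * mat_sqrt A)"
    using power_mean_comparison(2)[OF A B zero_le_one zero_le_one N] by (simp add: one)
qed

end
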